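(* Let $n\geq 2$ and $\sigma\geq 1$, and let $f:\mathbb{B}^n\to\mathbb{B}^n$ be a homeomorphism such that $\operatorname{skew}_\rho(f(T))\leq\sigma$ for every equilateral hyperbolic triangle $T\subset\mathbb{B}^n$. Then $f$ is quasiconformal.
   Context: $\mathbb{B}^n$ is the open unit ball in $\mathbb{R}^n$, and $\rho$ is the hyperbolic metric on $\mathbb{B}^n$, i.e. the path metric obtained from the density $\frac{2|dx|}{1-|x|^2}$. A homeomorphism $f:\mathbb{B}^n\to\mathbb{B}^n$ is onto. An equilateral hyperbolic triangle $T$ in $\mathbb{B}^n$ has three distinct vertices and three edges that are hyperbolic geodesic segments of equal length joining the vertices. For a topological triangle $T\subset\mathbb{B}^n$ with vertices $v_1,v_2,v_3$, the hyperbolic skew is $$\operatorname{skew}_\rho(T)=\frac{\max_{i\neq j}\rho(v_i,v_j)}{\min_{i\neq j}\rho(v_i,v_j)}.$$ If $T$ is an equilateral hyperbolic triangle with vertices $v_1,v_2,v_3$, then $f(T)$ is a topological triangle with vertices $f(v_1),f(v_2),f(v_3)$. Quasiconformal (metric definition): a homeomorphism $f$ of a domain $U\subset\mathbb{R}^n$ onto its image in $\mathbb{R}^n$ is quasiconformal if there is a constant $H$ such that $\limsup_{r\to0}H(x,r)\leq H$ for all $x\in U$, where $$H(x,r)=\frac{\max_{|x-y|=r}|f(x)-f(y)|}{\min_{|x-y|=r}|f(x)-f(y)|}.$$ *)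

theory Defs
  imports "HOL-Analysis.Analysis"
begin

text \<open>The hyperbolic metric on the open unit ball is the path metric of the density
  \<open>2|dx| / (1 - |x|^2)\<close>; the infimum is taken over piecewise \<open>C\<^sup>1\<close> paths of finite length in the
  ball. Finiteness has to be demanded: \<^const>\<open>valid_path\<close> does not bound the derivative near
  the finitely many exceptional points, so such a path may have infinite length, and then
  \<^const>\<open>integral\<close> returns \<open>0\<close>.\<close>

definition hyp_speed :: "(real \<Rightarrow> 'a::euclidean_space) \<Rightarrow> real \<Rightarrow> real" where
  "hyp_speed \<gamma> t =
     2 * norm (vector_derivative \<gamma> (at t within {0..1})) / (1 - (norm (\<gamma> t))\<^sup>2)"

definition hyp_length :: "(real \<Rightarrow> 'a::euclidean_space) \<Rightarrow> real" where
  "hyp_length \<gamma> = integral {0..1} (hyp_speed \<gamma>)"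

definition hyp_dist :: "'a::euclidean_space \<Rightarrow> 'a \<Rightarrow> real" where
  "hyp_dist x y = Inf {hyp_length \<gamma> | \<gamma>. valid_path \<gamma> \<and> path_image \<gamma> \<subseteq> ball 0 1 \<and>
     pathstart \<gamma> = x \<and> pathfinish \<gamma> = y \<and> hyp_speed \<gamma> integrable_on {0..1}}"

text \<open>\<open>S\<close> is a geodesic segment of length \<open>L\<close> joining \<open>x\<close> and \<open>y\<close>: the image of an
  isometric embedding of \<open>[0, L]\<close> into the ball with its hyperbolic metric.\<close>

definition hyp_geodesic_segment :: "real \<Rightarrow> 'a::euclidean_space \<Rightarrow> 'a \<Rightarrow> 'a set \<Rightarrow> bool" where
  "hyp_geodesic_segment L x y S \<longleftrightarrow> 0 \<le> L \<and>
     (\<exists>c. c 0 = x \<and> c L = y \<and> c ` {0..L} = S \<and> S \<subseteq> ball 0 1 \<and>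
       (\<forall>s\<in>{0..L}. \<forall>t\<in>{0..L}. hyp_dist (c s) (c t) = \<bar>s - t\<bar>))"

text \<open>A triangle carries its three vertices and its three edges. Indices live in \<open>\<int>/3\<close>, and
  edge \<open>i\<close> is the side opposite to vertex \<open>i\<close>, joining the vertices \<open>i + 1\<close> and \<open>i + 2\<close>.
  The vertices are part of the data because those of a topological triangle are not
  determined by its point set.\<close>

datatype 'a triangle = Triangle (vertex: "3 \<Rightarrow> 'a") (edge: "3 \<Rightarrow> 'a set")

definition triangle_image :: "('a \<Rightarrow> 'b) \<Rightarrow> 'a triangle \<Rightarrow> 'b triangle" where
  "triangle_image f T = Triangle (\<lambda>i. f (vertex T i)) (\<lambda>i. f ` edge T i)"

definition equilateral_hyp_triangle :: "'a::euclidean_space triangle \<Rightarrow> bool" where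
  "equilateral_hyp_triangle T \<longleftrightarrow> inj (vertex T) \<and>
     (\<exists>L. \<forall>i. hyp_geodesic_segment L (vertex T (i + 1)) (vertex T (i + 2)) (edge T i))"

definition hyp_skew :: "'a::euclidean_space triangle \<Rightarrow> real" where
  "hyp_skew T =
     Max {hyp_dist (vertex T i) (vertex T j) | i j. i \<noteq> j} /
     Min {hyp_dist (vertex T i) (vertex T j) | i j. i \<noteq> j}"

text \<open>The metric definition of quasiconformality. If \<open>f\<close> is continuous and injective on
  \<open>cball x r\<close> with \<open>r > 0\<close>, the supremum and infimum below are attained and the infimum is
  positive. Values of \<open>f\<close> outside the domain \<open>U\<close> only affect the quotient for large \<open>r\<close>,
  hence not the upper limit.\<close>

definition linear_dilatation ::
    "('a::euclidean_space \<Rightarrow> 'b::euclidean_space) \<Rightarrow> 'a \<Rightarrow> real \<Rightarrow> real" where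
  "linear_dilatation f x r =
     (SUP y\<in>sphere x r. norm (f x - f y)) / (INF y\<in>sphere x r. norm (f x - f y))"

definition quasiconformal_on :: "('a::euclidean_space \<Rightarrow> 'a) \<Rightarrow> 'a set \<Rightarrow> bool" where
  "quasiconformal_on f U \<longleftrightarrow> open U \<and> connected U \<and> U \<noteq> {} \<and>
     (\<exists>g. homeomorphism U (f ` U) f g) \<and>
     (\<exists>H::real. \<forall>x\<in>U. Limsup (at_right 0) (\<lambda>r. ereal (linear_dilatation f x r)) \<le> ereal H)"

end

theory Submission
  imports Defs
begin

text \<open>The hyperbolic isometries act transitively on the ball and are conformal, so \<open>f\<close> may be replaced
  by a conjugate \<open>F\<close> with \<open>F 0 = 0\<close>, and everything reduces to the estimate
  \<open>norm (F y) \<le> C * norm (F z)\<close> for small \<open>z\<close> and \<open>norm y \<le> 2 * norm z\<close>, with \<open>C\<close> depending on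
  \<open>\<sigma>\<close> only. Near \<open>0\<close> the hypothesis on triangles says: if two vertices of an equilateral triangle are
  mapped into the ball of radius \<open>M\<close> about \<open>0\<close>, then the third one is mapped into the ball of radius
  \<open>K * M\<close>, where \<open>K = 1 + 12 * \<sigma>\<close>. So starting from points with small images, boundedly many
  completions of equilateral triangles produce further points with comparably small images.

  In dimension two, completions that start from two points yield little more than a triangular
  lattice, which need not come near a given point. What makes them reach a full disc is a whole
  curve of points with small images, and such a curve exists because \<open>F\<close> is a homeomorphism.
  Let \<open>r = norm z\<close>, let \<open>z\<^sub>0\<close> minimise \<open>norm (F p)\<close>
  over the sphere of radius \<open>r\<close>, and put \<open>\<epsilon> = norm (F z\<^sub>0)\<close>. The preimage \<open>\<gamma>\<close> of the segment
  from \<open>0\<close> to \<open>F z\<^sub>0\<close> joins \<open>0\<close> to \<open>z\<^sub>0\<close>, stays in the ball of radius \<open>r\<close> by minimality, and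
  \<open>norm (F p) \<le> \<epsilon>\<close> on it. Up to errors of order \<open>r\<^sup>3\<close>, the third vertex over \<open>p\<close> and \<open>q\<close> is
  \<open>(1 - \<zeta>) * p + \<zeta> * q\<close> with \<open>\<zeta> = exp (\<i> * pi / 3)\<close>. If \<open>p\<close> and \<open>q\<close> vary independently
  along \<open>\<gamma>\<close>, this is the sum of two curves with different directions, hence a genuinely
  two-dimensional set. Three completions about a common vertex \<open>e\<close> amount to the point reflection
  \<open>p \<mapsto> 2 * e - p\<close>, by which \<open>\<gamma>\<close> is prolonged to a curve that follows the line through \<open>0\<close> and
  \<open>z\<^sub>0\<close> over a long distance, with an error that stays bounded by a multiple of \<open>r\<close>. The
  sum of two copies is then a bounded perturbation of a linear isomorphism of the plane on a large
  disc, and by Brouwer's theorem it covers the disc of radius \<open>2 * r\<close> (\<open>fill_disc\<close>).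

  In higher dimension the curve need not lie in a plane. There, however, rotations by about sixty
  degrees move \<open>z\<^sub>0\<close> to every point of the sphere in at most four steps (\<open>rotation\<close>). Hence \<open>norm (F p)\<close>
  is comparable to \<open>\<epsilon>\<close> or smaller on the sphere, by the maximum principle also inside, and the planar
  argument applies to a radius in any plane through \<open>0\<close>.

  All of this needs the hyperbolic metric in closed form. The map \<open>hyp_swap a\<close> is the isometric
  involution that exchanges \<open>0\<close> and \<open>a\<close>. It provides the geodesics, the normalisation of \<open>f\<close> and
  the third vertex of an equilateral triangle.\<close>

section \<open>A lower bound for hyperbolic length\<close>

text \<open>The closed form of the distance is \<open>2 * arsinh (sqrt (hyp_quot x y))\<close>, see \<open>hyp_dist_eq\<close>.\<close>

definition hyp_quot :: "'a::euclidean_space \<Rightarrow> 'a \<Rightarrow> real" where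
  "hyp_quot x y = (norm (x - y))\<^sup>2 / ((1 - (norm x)\<^sup>2) * (1 - (norm y)\<^sup>2))"

lemma one_minus_norm_sq_pos: "norm x < 1 \<Longrightarrow> 0 < 1 - (norm (x::'a::real_normed_vector))\<^sup>2"
  by (simp add: abs_square_less_1)

lemma hyp_quot_nonneg: "norm x < 1 \<Longrightarrow> norm y < 1 \<Longrightarrow> 0 \<le> hyp_quot x y"
  using one_minus_norm_sq_pos[of x] one_minus_norm_sq_pos[of y] by (simp add: hyp_quot_def)

lemma hyp_quot_commute: "hyp_quot x y = hyp_quot y x"
  by (simp add: hyp_quot_def norm_minus_commute mult.commute)

lemma hyp_quot_eq_0_iff: "norm x < 1 \<Longrightarrow> norm y < 1 \<Longrightarrow> hyp_quot x y = 0 \<longleftrightarrow> x = y"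
  using one_minus_norm_sq_pos[of x] one_minus_norm_sq_pos[of y] by (simp add: hyp_quot_def)

text \<open>The left-hand side is the absolute value of the derivative of \<open>hyp_quot x\<close> at \<open>p\<close> in direction
  \<open>v\<close>. Since \<open>2 * arsinh (sqrt k)\<close> has derivative \<open>1 / sqrt (k * (k + 1))\<close>, the bound says that
  \<open>2 * arsinh (sqrt (hyp_quot x p))\<close> is 1-Lipschitz for the hyperbolic density. The gradient is a
  multiple of the vector \<open>w\<close> of the proof, whose norm has a closed form.\<close>

lemma hyp_quot_grad_bound:
  fixes x p v :: "'a::euclidean_space"
  assumes "norm x < 1" "norm p < 1"
  defines "k \<equiv> hyp_quot x p"
  shows "\<bar>(2 * ((p - x) \<bullet> v) * (1 - (norm p)\<^sup>2) + (norm (p - x))\<^sup>2 * (2 * (p \<bullet> v)))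
            / ((1 - (norm x)\<^sup>2) * (1 - (norm p)\<^sup>2)\<^sup>2)\<bar>
      \<le> 2 * norm v / (1 - (norm p)\<^sup>2) * sqrt (k * (k + 1))"
proof -
  define A where "A = 1 - (norm x)\<^sup>2"
  define B where "B = 1 - (norm p)\<^sup>2"
  define w where "w = B *\<^sub>R (p - x) + (norm (p - x))\<^sup>2 *\<^sub>R p"
  have pos: "A > 0" "B > 0"
    using assms one_minus_norm_sq_pos by (auto simp: A_def B_def)
  have k: "k = (norm (p - x))\<^sup>2 / (A * B)"
    by (simp add: k_def hyp_quot_def A_def B_def norm_minus_commute)
  have w2: "(norm w)\<^sup>2 = (norm (p - x))\<^sup>2 * ((norm (p - x))\<^sup>2 + A * B)"
    unfolding w_def A_def B_def power2_norm_eq_inner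
    by (simp add: inner_simps inner_commute algebra_simps)
  have "(A * B)\<^sup>2 * (k * (k + 1)) = (norm w)\<^sup>2"
    using pos unfolding w2 k by (simp add: field_simps power2_eq_square)
  then have nw: "norm w = A * B * sqrt (k * (k + 1))"
    using pos by (metis abs_of_pos mult_pos_pos norm_ge_zero real_sqrt_abs real_sqrt_mult real_sqrt_pow2
      real_sqrt_power)
  have "2 * ((p - x) \<bullet> v) * B + (norm (p - x))\<^sup>2 * (2 * (p \<bullet> v)) = 2 * (w \<bullet> v)"
    by (simp add: w_def inner_simps algebra_simps)
  then have "\<bar>(2 * ((p - x) \<bullet> v) * B + (norm (p - x))\<^sup>2 * (2 * (p \<bullet> v))) / (A * B\<^sup>2)\<bar> = 2 * \<bar>w \<bullet> v\<bar> / (A * B\<^sup>2)"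
    using pos by (simp add: abs_mult)
  also have "\<dots> \<le> 2 * (norm w * norm v) / (A * B\<^sup>2)"
    using pos Cauchy_Schwarz_ineq2[of w v] by (intro divide_right_mono) auto
  also have "\<dots> = 2 * norm v / B * sqrt (k * (k + 1))"
    using pos unfolding nw by (simp add: field_simps power2_eq_square)
  finally show ?thesis
    by (simp add: A_def B_def)
qed

lemma hyp_length_ge:
  fixes \<gamma> :: "real \<Rightarrow> 'a::euclidean_space"
  assumes \<gamma>: "valid_path \<gamma>" "path_image \<gamma> \<subseteq> ball 0 1" and int: "hyp_speed \<gamma> integrable_on {0..1}"
  shows "2 * arsinh (sqrt (hyp_quot (pathstart \<gamma>) (pathfinish \<gamma>))) \<le> hyp_length \<gamma>"
proof -
  define x where "x = pathstart \<gamma>"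
  have ball: "norm (\<gamma> t) < 1" if "t \<in> {0..1}" for t
    using \<gamma>(2) that by (force simp: path_image_def)
  have x: "norm x < 1" using ball[of 0] by (simp add: x_def pathstart_def)
  obtain S D where S: "finite S" and cont: "continuous_on {0..1} \<gamma>"
    and D: "\<And>t. t \<in> {0..1} - S \<Longrightarrow> (\<gamma> has_vector_derivative D t) (at t)"
    using \<gamma>(1) unfolding valid_path_def piecewise_C1_differentiable_on_def C1_differentiable_on_def
    by blast
  define k where "k t = hyp_quot x (\<gamma> t)" for t
  have k0: "k t \<ge> 0" if "t \<in> {0..1}" for t
    unfolding k_def using hyp_quot_nonneg x ball that by blast
  have kcont: "continuous_on {0..1} k"
    unfolding k_def hyp_quot_def
    using one_minus_norm_sq_pos[OF x] one_minus_norm_sq_pos[OF ball]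
    by (intro continuous_intros cont) force
  define k' where "k' t = (2 * ((\<gamma> t - x) \<bullet> D t) * (1 - (norm (\<gamma> t))\<^sup>2) + (norm (\<gamma> t - x))\<^sup>2 * (2 * (\<gamma> t \<bullet> D t)))
            / ((1 - (norm x)\<^sup>2) * (1 - (norm (\<gamma> t))\<^sup>2)\<^sup>2)" for t
  have kder: "(k has_vector_derivative k' t) (at t)" if t: "t \<in> {0..1} - S" for t
  proof -
    have pos: "0 < 1 - (norm x)\<^sup>2" "0 < 1 - (norm (\<gamma> t))\<^sup>2"
      using x ball[of t] t one_minus_norm_sq_pos by auto
    have eq: "k = (\<lambda>t. ((\<gamma> t - x) \<bullet> (\<gamma> t - x)) / ((1 - (norm x)\<^sup>2) * (1 - \<gamma> t \<bullet> \<gamma> t)))"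
      by (rule ext) (simp add: k_def hyp_quot_def power2_norm_eq_inner inner_simps inner_commute)
    have d: "(\<gamma> has_derivative (\<lambda>h. h *\<^sub>R D t)) (at t)"
      using D[OF t] by (simp add: has_vector_derivative_def)
    have n: "((\<lambda>t. (\<gamma> t - x) \<bullet> (\<gamma> t - x)) has_real_derivative 2 * ((\<gamma> t - x) \<bullet> D t)) (at t)"
      unfolding has_field_derivative_def
      by (rule derivative_eq_intros d refl)+ (simp add: fun_eq_iff inner_commute)
    have q: "((\<lambda>t. 1 - \<gamma> t \<bullet> \<gamma> t) has_real_derivative - 2 * (\<gamma> t \<bullet> D t)) (at t)"
      unfolding has_field_derivative_def
      by (rule derivative_eq_intros d refl)+ (simp add: fun_eq_iff inner_commute)
    define A where "A = 1 - (norm x)\<^sup>2"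
    define B where "B = 1 - \<gamma> t \<bullet> \<gamma> t"
    have B: "B = 1 - (norm (\<gamma> t))\<^sup>2" by (simp add: B_def power2_norm_eq_inner)
    have pos: "A \<noteq> 0" "B \<noteq> 0" using pos by (auto simp: A_def B)
    have "(k has_real_derivative (2 * ((\<gamma> t - x) \<bullet> D t) * (A * B) -
            ((\<gamma> t - x) \<bullet> (\<gamma> t - x)) * (A * (- 2 * (\<gamma> t \<bullet> D t)))) / (A * B * (A * B))) (at t)"
      unfolding eq A_def[symmetric] unfolding B_def
      by (rule DERIV_divide[OF n DERIV_cmult[OF q]]) (use pos in \<open>auto simp: B_def\<close>)
    also have "(2 * ((\<gamma> t - x) \<bullet> D t) * (A * B) -
            ((\<gamma> t - x) \<bullet> (\<gamma> t - x)) * (A * (- 2 * (\<gamma> t \<bullet> D t)))) / (A * B * (A * B)) = k' t"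
    proof -
      have "(2 * a * (A * B) - n * (A * (- 2 * g))) / (A * B * (A * B)) = (2 * a * B + n * (2 * g)) / (A * B\<^sup>2)"
        for a n g :: real
        using pos by (simp add: field_simps power2_eq_square)
      then show ?thesis
        unfolding k'_def A_def[symmetric] B[symmetric] by (simp only: power2_norm_eq_inner)
    qed
    finally show ?thesis by (simp add: has_real_derivative_iff_has_vector_derivative)
  qed
  \<comment> \<open>The shift by \<open>e\<close> avoids the singularity of the square root at \<open>k = 0\<close>. It is harmless because \<open>k * (k + 1)\<close> only grows.\<close>
  have main: "2 * arsinh (sqrt (k 1 + e)) - 2 * arsinh (sqrt (k 0 + e)) \<le> hyp_length \<gamma>" if e: "e > 0" for e
  proof -
    define h' where "h' t = (if t \<in> S then 0 else k' t / sqrt ((k t + e) * (k t + e + 1)))" for t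
    have der: "((\<lambda>t. 2 * arsinh (sqrt (k t + e))) has_vector_derivative h' t) (at t)" if t: "t \<in> {0..1} - S" for t
    proof -
      have p: "0 < k t + e" using k0[of t] t e by auto
      have r: "(k has_real_derivative k' t) (at t)"
        using kder[OF t] by (simp add: has_real_derivative_iff_has_vector_derivative)
      have sq: "((\<lambda>t. sqrt (k t + e)) has_real_derivative k' t / (2 * sqrt (k t + e))) (at t)"
        using p by (auto intro!: derivative_eq_intros r simp: divide_simps)
      have "((\<lambda>t. 2 * arsinh (sqrt (k t + e))) has_real_derivative
          2 * (1 / sqrt ((sqrt (k t + e))\<^sup>2 + 1) * (k' t / (2 * sqrt (k t + e))))) (at t)"
        by (rule DERIV_cmult[OF DERIV_chain2[OF arsinh_real_has_field_derivative sq]])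
      also have "2 * (1 / sqrt ((sqrt (k t + e))\<^sup>2 + 1) * (k' t / (2 * sqrt (k t + e)))) = h' t"
        using p t by (simp add: h'_def real_sqrt_mult)
      finally have "((\<lambda>t. 2 * arsinh (sqrt (k t + e))) has_real_derivative h' t) (at t)" .
      then show ?thesis by (simp add: has_real_derivative_iff_has_vector_derivative)
    qed
    have I: "(h' has_integral 2 * arsinh (sqrt (k 1 + e)) - 2 * arsinh (sqrt (k 0 + e))) {0..1}"
    proof (rule fundamental_theorem_of_calculus_strong[OF S])
      show "continuous_on {0..1} (\<lambda>t. 2 * arsinh (sqrt (k t + e)))"
        by (intro continuous_intros kcont)
    qed (use der in auto)
    have le: "h' t \<le> hyp_speed \<gamma> t" if t: "t \<in> {0..1}" for t
    proof (cases "t \<in> S")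
      case True
      then show ?thesis
        using one_minus_norm_sq_pos[OF ball[OF t]] by (simp add: h'_def hyp_speed_def)
    next
      case False
      have p: "0 \<le> k t" using k0 t by auto
      have vd: "vector_derivative \<gamma> (at t within {0..1}) = D t"
        using D[of t] t False
        by (intro vector_derivative_at_within_ivl) auto
      have "k' t \<le> hyp_speed \<gamma> t * sqrt (k t * (k t + 1))"
        using hyp_quot_grad_bound[OF x ball[OF t], of "D t"]
        unfolding hyp_speed_def vd k'_def k_def by linarith
      also have "\<dots> \<le> hyp_speed \<gamma> t * sqrt ((k t + e) * (k t + e + 1))"
        using p e one_minus_norm_sq_pos[OF ball[OF t]]
        by (intro mult_left_mono real_sqrt_le_mono mult_mono) (auto simp: hyp_speed_def)
      finally show ?thesis
        using p e False by (simp add: h'_def divide_le_eq)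
    qed
    show ?thesis
      unfolding hyp_length_def
      using has_integral_le[OF I integrable_integral[OF int] le] by simp
  qed
  have "((\<lambda>e. 2 * arsinh (sqrt (k 1 + e)) - 2 * arsinh (sqrt (k 0 + e))) \<longlongrightarrow>
        2 * arsinh (sqrt (k 1 + 0)) - 2 * arsinh (sqrt (k 0 + 0))) (at_right 0)"
    by (intro tendsto_intros)
  moreover have "eventually (\<lambda>e. 2 * arsinh (sqrt (k 1 + e)) - 2 * arsinh (sqrt (k 0 + e)) \<le> hyp_length \<gamma>) (at_right 0)"
    using main by (auto simp: eventually_at_right_field intro: exI[of _ 1])
  ultimately have "2 * arsinh (sqrt (k 1 + 0)) - 2 * arsinh (sqrt (k 0 + 0)) \<le> hyp_length \<gamma>"
    by (rule tendsto_upperbound) simp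
  then show ?thesis
    by (simp add: k_def x_def pathstart_def pathfinish_def hyp_quot_def)
qed

section \<open>The isometric involution exchanging two points\<close>

text \<open>In complex notation this is \<open>x \<mapsto> (a - x) / (1 - cnj a * x)\<close>. The formula makes sense in every
  dimension and, unlike the inversion in a sphere orthogonal to the unit sphere, also for \<open>a = 0\<close>.\<close>

definition hyp_swap :: "'a::euclidean_space \<Rightarrow> 'a \<Rightarrow> 'a" where
  "hyp_swap a x = ((1 - (norm a)\<^sup>2) *\<^sub>R (a - x) + (norm (x - a))\<^sup>2 *\<^sub>R a)
                    /\<^sub>R (1 - 2 * (a \<bullet> x) + (norm a)\<^sup>2 * (norm x)\<^sup>2)"

lemma hyp_swap_denom_eq:
  "1 - 2 * (a \<bullet> x) + (norm a)\<^sup>2 * (norm x)\<^sup>2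
     = (norm (a - x))\<^sup>2 + (1 - (norm a)\<^sup>2) * (1 - (norm (x::'a::euclidean_space))\<^sup>2)"
  unfolding power2_norm_eq_inner by (simp add: inner_simps inner_commute algebra_simps)

lemma hyp_swap_denom_pos:
  assumes "norm a < 1" "norm (x::'a::euclidean_space) < 1"
  shows "0 < 1 - 2 * (a \<bullet> x) + (norm a)\<^sup>2 * (norm x)\<^sup>2"
  unfolding hyp_swap_denom_eq
  using one_minus_norm_sq_pos[OF assms(1)] one_minus_norm_sq_pos[OF assms(2)]
  by (simp add: add_nonneg_pos)

lemma hyp_swap_0 [simp]: "hyp_swap a 0 = a"
  by (simp add: hyp_swap_def scaleR_left_diff_distrib)

lemma hyp_swap_self [simp]: "hyp_swap a a = 0"
  by (simp add: hyp_swap_def)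

text \<open>All metric properties of \<open>hyp_swap a\<close> follow from this expression in the inner products of the
  data.\<close>

lemma inner_hyp_swap:
  fixes a x y :: "'a::euclidean_space"
  assumes "norm a < 1" "norm x < 1" "norm y < 1"
  shows "hyp_swap a x \<bullet> hyp_swap a y
     = ((1 - 2 * (a \<bullet> x) + (norm x)\<^sup>2) * (1 - 2 * (a \<bullet> y) + (norm y)\<^sup>2) * (norm a)\<^sup>2
        - (1 - (norm a)\<^sup>2) * (1 - 2 * (a \<bullet> x) + (norm x)\<^sup>2) * (a \<bullet> y)
        - (1 - (norm a)\<^sup>2) * (1 - 2 * (a \<bullet> y) + (norm y)\<^sup>2) * (a \<bullet> x)
        + (1 - (norm a)\<^sup>2)\<^sup>2 * (x \<bullet> y))
       / ((1 - 2 * (a \<bullet> x) + (norm a)\<^sup>2 * (norm x)\<^sup>2) * (1 - 2 * (a \<bullet> y) + (norm a)\<^sup>2 * (norm y)\<^sup>2))"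
proof -
  have eq: "(1 - (norm a)\<^sup>2) *\<^sub>R (a - z) + (norm (z - a))\<^sup>2 *\<^sub>R a
      = (1 - 2 * (a \<bullet> z) + (norm z)\<^sup>2) *\<^sub>R a - (1 - (norm a)\<^sup>2) *\<^sub>R z" for z
    unfolding power2_norm_eq_inner by (simp add: inner_simps inner_commute algebra_simps)
  show ?thesis
    unfolding hyp_swap_def eq
    by (simp add: inner_diff_left inner_diff_right inner_commute power2_norm_eq_inner[symmetric]
         divide_inverse) (simp add: algebra_simps power2_eq_square)
qed

lemma one_minus_norm_sq_hyp_swap:
  assumes "norm a < 1" "norm (x::'a::euclidean_space) < 1"
  shows "1 - (norm (hyp_swap a x))\<^sup>2
     = (1 - (norm a)\<^sup>2) * (1 - (norm x)\<^sup>2) / (1 - 2 * (a \<bullet> x) + (norm a)\<^sup>2 * (norm x)\<^sup>2)"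
proof -
  define A p X where "A = (norm a)\<^sup>2" and "p = a \<bullet> x" and "X = (norm x)\<^sup>2"
  have D: "1 - 2 * p + A * X \<noteq> 0"
    using hyp_swap_denom_pos[OF assms] by (simp add: A_def p_def X_def)
  have "(norm (hyp_swap a x))\<^sup>2 = hyp_swap a x \<bullet> hyp_swap a x"
    by (rule power2_norm_eq_inner)
  also have "\<dots> = ((1 - 2 * p + X) * (1 - 2 * p + X) * A - (1 - A) * (1 - 2 * p + X) * p
        - (1 - A) * (1 - 2 * p + X) * p + (1 - A)\<^sup>2 * X)
       / ((1 - 2 * p + A * X) * (1 - 2 * p + A * X))"
    unfolding inner_hyp_swap[OF assms(1,2,2)] by (simp add: A_def p_def X_def power2_norm_eq_inner)
  also have "(1 - 2 * p + X) * (1 - 2 * p + X) * A - (1 - A) * (1 - 2 * p + X) * p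
        - (1 - A) * (1 - 2 * p + X) * p + (1 - A)\<^sup>2 * X = (1 - 2 * p + A * X) * (A - 2 * p + X)"
    by (simp add: algebra_simps power2_eq_square)
  also have "\<dots> / ((1 - 2 * p + A * X) * (1 - 2 * p + A * X)) = (A - 2 * p + X) / (1 - 2 * p + A * X)"
    using D by simp
  finally show ?thesis
    unfolding A_def[symmetric] p_def[symmetric] X_def[symmetric]
    using D by (simp add: field_simps)
qed

lemma norm_hyp_swap_less_1:
  assumes "norm a < 1" "norm (x::'a::euclidean_space) < 1"
  shows "norm (hyp_swap a x) < 1"
proof -
  have "0 < 1 - (norm (hyp_swap a x))\<^sup>2"
    unfolding one_minus_norm_sq_hyp_swap[OF assms]
    using hyp_swap_denom_pos[OF assms] one_minus_norm_sq_pos[OF assms(1)] one_minus_norm_sq_pos[OF assms(2)]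
    by simp
  then show ?thesis
    by (simp add: abs_square_less_1)
qed

lemma norm_sq_hyp_swap_diff:
  fixes a x y :: "'a::euclidean_space"
  assumes "norm a < 1" "norm x < 1" "norm y < 1"
  shows "(norm (hyp_swap a x - hyp_swap a y))\<^sup>2
     = (1 - (norm a)\<^sup>2)\<^sup>2 * (norm (x - y))\<^sup>2
       / ((1 - 2 * (a \<bullet> x) + (norm a)\<^sup>2 * (norm x)\<^sup>2) * (1 - 2 * (a \<bullet> y) + (norm a)\<^sup>2 * (norm y)\<^sup>2))"
proof -
  define A p q X Y s where "A = (norm a)\<^sup>2" and "p = a \<bullet> x" and "q = a \<bullet> y"
    and "X = (norm x)\<^sup>2" and "Y = (norm y)\<^sup>2" and "s = x \<bullet> y"
  define P Q where "P = 1 - 2 * p + A * X" and "Q = 1 - 2 * q + A * Y"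
  have PQ: "P \<noteq> 0" "Q \<noteq> 0"
    using hyp_swap_denom_pos[OF assms(1,2)] hyp_swap_denom_pos[OF assms(1,3)]
    by (simp_all add: A_def p_def q_def X_def Y_def P_def Q_def)
  have 1: "(norm (hyp_swap a x))\<^sup>2 = 1 - (1 - A) * (1 - X) / P"
    and 2: "(norm (hyp_swap a y))\<^sup>2 = 1 - (1 - A) * (1 - Y) / Q"
    using one_minus_norm_sq_hyp_swap[OF assms(1,2)] one_minus_norm_sq_hyp_swap[OF assms(1,3)]
    by (simp_all add: A_def p_def q_def X_def Y_def P_def Q_def)
  have 3: "hyp_swap a x \<bullet> hyp_swap a y = ((1 - 2 * p + X) * (1 - 2 * q + Y) * A
     - (1 - A) * (1 - 2 * p + X) * q - (1 - A) * (1 - 2 * q + Y) * p + (1 - A)\<^sup>2 * s) / (P * Q)"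
    unfolding inner_hyp_swap[OF assms] by (simp add: A_def p_def q_def X_def Y_def P_def Q_def s_def)
  have "(norm (hyp_swap a x - hyp_swap a y))\<^sup>2 =
      (norm (hyp_swap a x))\<^sup>2 + (norm (hyp_swap a y))\<^sup>2 - 2 * (hyp_swap a x \<bullet> hyp_swap a y)"
    unfolding power2_norm_eq_inner by (simp add: inner_simps inner_commute)
  also have "\<dots> = ((1 - A)\<^sup>2 * (X + Y - 2 * s)) / (P * Q)"
  proof -
    have "(1 - (1 - A) * (1 - X) / P) + (1 - (1 - A) * (1 - Y) / Q)
        = (2 * P * Q - (1 - A) * (1 - X) * Q - (1 - A) * (1 - Y) * P) / (P * Q)"
      using PQ by (simp add: field_simps)
    moreover have "(2 * P * Q - (1 - A) * (1 - X) * Q - (1 - A) * (1 - Y) * P)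
        - 2 * ((1 - 2 * p + X) * (1 - 2 * q + Y) * A
     - (1 - A) * (1 - 2 * p + X) * q - (1 - A) * (1 - 2 * q + Y) * p + (1 - A)\<^sup>2 * s) = (1 - A)\<^sup>2 * (X + Y - 2 * s)"
      by (simp add: P_def Q_def algebra_simps power2_eq_square)
    ultimately show ?thesis
      unfolding 1 2 3 by (metis diff_divide_distrib times_divide_eq_right)
  qed
  also have "X + Y - 2 * s = (norm (x - y))\<^sup>2"
    unfolding X_def Y_def s_def power2_norm_eq_inner by (simp add: inner_simps inner_commute)
  finally show ?thesis
    by (simp add: A_def p_def q_def X_def Y_def P_def Q_def)
qed

lemma hyp_quot_hyp_swap:
  assumes "norm a < 1" "norm x < 1" "norm (y::'a::euclidean_space) < 1"
  shows "hyp_quot (hyp_swap a x) (hyp_swap a y) = hyp_quot x y"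
proof -
  have "c\<^sup>2 * n / (P * Q) / ((c * X / P) * (c * Y / Q)) = n / (X * Y)"
    if "0 < P" "0 < Q" "0 < c" for c n P Q X Y :: real
    using that by (simp add: field_simps power2_eq_square)
  then show ?thesis
    unfolding hyp_quot_def norm_sq_hyp_swap_diff[OF assms] one_minus_norm_sq_hyp_swap[OF assms(1,2)]
      one_minus_norm_sq_hyp_swap[OF assms(1,3)]
    using hyp_swap_denom_pos[OF assms(1,2)] hyp_swap_denom_pos[OF assms(1,3)]
      one_minus_norm_sq_pos[OF assms(1)] by blast
qed

lemma hyp_swap_hyp_swap:
  assumes "norm a < 1" "norm (x::'a::euclidean_space) < 1"
  shows "hyp_swap a (hyp_swap a x) = x"
proof -
  define A p X where "A = (norm a)\<^sup>2" and "p = a \<bullet> x" and "X = (norm x)\<^sup>2"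
  define D where "D = 1 - 2 * p + A * X"
  have D: "D \<noteq> 0" and A: "1 - A \<noteq> 0"
    using hyp_swap_denom_pos[OF assms] one_minus_norm_sq_pos[OF assms(1)]
    by (simp_all add: A_def p_def X_def D_def)
  have eq: "hyp_swap a z = ((1 - 2 * (a \<bullet> z) + (norm z)\<^sup>2) *\<^sub>R a - (1 - A) *\<^sub>R z)
      /\<^sub>R (1 - 2 * (a \<bullet> z) + A * (norm z)\<^sup>2)" for z
    unfolding hyp_swap_def A_def power2_norm_eq_inner
    by (simp add: inner_simps inner_commute algebra_simps)
  define y where "y = hyp_swap a x"
  have y: "y = ((1 - 2 * p + X) *\<^sub>R a - (1 - A) *\<^sub>R x) /\<^sub>R D"
    unfolding y_def eq[of x] by (simp add: A_def p_def X_def D_def)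
  have ay: "D * (a \<bullet> y) = (1 - 2 * p + X) * A - (1 - A) * p"
    using D by (simp add: y inner_simps A_def power2_norm_eq_inner[symmetric] p_def)
  have Y: "D * (norm y)\<^sup>2 = D - (1 - A) * (1 - X)"
    using one_minus_norm_sq_hyp_swap[OF assms] D
    unfolding y_def[symmetric] A_def[symmetric] p_def[symmetric] X_def[symmetric] D_def[symmetric]
    by (simp add: field_simps)
  have "D * (1 - 2 * (a \<bullet> y) + A * (norm y)\<^sup>2) = D - 2 * (D * (a \<bullet> y)) + A * (D * (norm y)\<^sup>2)"
    by (simp add: algebra_simps)
  also have "\<dots> = (1 - A)\<^sup>2"
    unfolding ay Y by (simp add: D_def algebra_simps power2_eq_square)
  finally have den: "1 - 2 * (a \<bullet> y) + A * (norm y)\<^sup>2 = (1 - A)\<^sup>2 / D"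
    using D by (simp add: field_simps)
  have "D * (1 - 2 * (a \<bullet> y) + (norm y)\<^sup>2) = D - 2 * (D * (a \<bullet> y)) + D * (norm y)\<^sup>2"
    by (simp add: algebra_simps)
  also have "\<dots> = (1 - A) * (1 - 2 * p + X)"
    unfolding ay Y by (simp add: D_def algebra_simps power2_eq_square)
  finally have num: "1 - 2 * (a \<bullet> y) + (norm y)\<^sup>2 = (1 - A) * (1 - 2 * p + X) / D"
    using D by (simp add: field_simps)
  have "(c * k / D) *\<^sub>R a - c *\<^sub>R ((k *\<^sub>R a - c *\<^sub>R x) /\<^sub>R D) = (c\<^sup>2 / D) *\<^sub>R x" for c k
    by (simp add: scaleR_diff_right power2_eq_square divide_inverse mult.commute mult.left_commute)
  then have "hyp_swap a y = ((1 - A)\<^sup>2 / D) *\<^sub>R x /\<^sub>R ((1 - A)\<^sup>2 / D)"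
    unfolding eq[of y] den num unfolding y by simp
  also have "\<dots> = x"
    using D A by simp
  finally show ?thesis by (simp add: y_def)
qed

lemma continuous_on_hyp_swap:
  fixes f g :: "'b::topological_space \<Rightarrow> 'a::euclidean_space"
  assumes "continuous_on S f" "continuous_on S g"
    and "\<And>s. s \<in> S \<Longrightarrow> norm (f s) < 1" "\<And>s. s \<in> S \<Longrightarrow> norm (g s) < 1"
  shows "continuous_on S (\<lambda>s. hyp_swap (f s) (g s))"
proof -
  have "\<forall>s\<in>S. 1 - 2 * (f s \<bullet> g s) + (norm (f s))\<^sup>2 * (norm (g s))\<^sup>2 \<noteq> 0"
    using hyp_swap_denom_pos assms(3,4) by fastforce
  then show ?thesis
    unfolding hyp_swap_def by (intro continuous_intros assms(1,2)) auto
qed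

section \<open>The closed form of the hyperbolic distance\<close>

text \<open>The diameter in direction \<open>u\<close>, parametrised by hyperbolic arc length and moved from \<open>0\<close> to
  \<open>x\<close> by an isometry.\<close>

definition hyp_line :: "'a::euclidean_space \<Rightarrow> 'a \<Rightarrow> real \<Rightarrow> 'a" where
  "hyp_line x u s = hyp_swap x (tanh (s / 2) *\<^sub>R u)"

lemma arsinh_real_nonneg: "0 \<le> x \<Longrightarrow> 0 \<le> arsinh (x::real)"
  using arsinh_real_neg_iff[of x] by linarith

lemma norm_tanh_scaleR: "norm u = 1 \<Longrightarrow> norm (tanh (s::real) *\<^sub>R u) < 1"
  using tanh_real_bounds[of s] by auto

lemma norm_hyp_line: "norm x < 1 \<Longrightarrow> norm u = 1 \<Longrightarrow> norm (hyp_line x u s) < 1"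
  unfolding hyp_line_def by (intro norm_hyp_swap_less_1 norm_tanh_scaleR)

lemma hyp_quot_hyp_line:
  assumes "norm x < 1" "norm u = 1"
  shows "hyp_quot (hyp_line x u s) (hyp_line x u t) = (sinh ((s - t) / 2))\<^sup>2"
proof -
  define a b :: real where "a = s / 2" and "b = t / 2"
  have c: "cosh a > 0" "cosh b > 0" by (auto simp: cosh_real_pos)
  have "hyp_quot (hyp_line x u s) (hyp_line x u t) = hyp_quot (tanh a *\<^sub>R u) (tanh b *\<^sub>R u)"
    unfolding hyp_line_def a_def b_def using assms by (intro hyp_quot_hyp_swap norm_tanh_scaleR)
  also have "\<dots> = (tanh a - tanh b)\<^sup>2 / ((1 - (tanh a)\<^sup>2) * (1 - (tanh b)\<^sup>2))"
    using assms by (simp add: hyp_quot_def scaleR_left_diff_distrib[symmetric] power_mult_distrib)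
  also have "tanh a - tanh b = sinh (a - b) / (cosh a * cosh b)"
    using c by (simp add: tanh_def sinh_diff field_simps)
  also have "1 - (tanh a)\<^sup>2 = 1 / (cosh a)\<^sup>2"
    using c by (simp add: tanh_def sinh_square_eq field_simps)
  also have "1 - (tanh b)\<^sup>2 = 1 / (cosh b)\<^sup>2"
    using c by (simp add: tanh_def sinh_square_eq field_simps)
  also have "(sinh (a - b) / (cosh a * cosh b))\<^sup>2 / (1 / (cosh a)\<^sup>2 * (1 / (cosh b)\<^sup>2)) = (sinh (a - b))\<^sup>2"
    using c by (simp add: field_simps)
  finally show ?thesis by (simp add: a_def b_def diff_divide_distrib)
qed

lemma ex_hyp_line:
  assumes "norm x < 1" "norm (y::'a::euclidean_space) < 1"
  obtains u where "norm u = 1" "hyp_line x u (2 * arsinh (sqrt (hyp_quot x y))) = y"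
proof -
  define v where "v = hyp_swap x y"
  have v: "norm v < 1" using norm_hyp_swap_less_1[OF assms] by (simp add: v_def)
  define l where "l = arsinh (sqrt (hyp_quot x y))"
  have "(sinh l)\<^sup>2 = hyp_quot x y"
    using hyp_quot_nonneg[OF assms] by (simp add: l_def)
  also have "\<dots> = hyp_quot 0 v"
    using hyp_quot_hyp_swap[OF assms(1) assms(1) assms(2)] by (simp add: v_def)
  also have "\<dots> = (norm v)\<^sup>2 / (1 - (norm v)\<^sup>2)"
    by (simp add: hyp_quot_def)
  finally have "(sinh l)\<^sup>2 * (1 - (norm v)\<^sup>2) = (norm v)\<^sup>2"
    using one_minus_norm_sq_pos[OF v] by (simp add: field_simps)
  then have "(sinh l)\<^sup>2 = (norm v * cosh l)\<^sup>2"
    by (simp add: power_mult_distrib cosh_square_eq algebra_simps)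
  moreover have "0 \<le> l" using hyp_quot_nonneg[OF assms] by (simp add: l_def arsinh_real_nonneg)
  ultimately have "sinh l = norm v * cosh l"
    using cosh_real_pos[of l] by (subst (asm) power2_eq_iff_nonneg) auto
  then have nv: "tanh l = norm v"
    using cosh_real_pos[of l] by (simp add: tanh_def)
  obtain e :: 'a where e: "norm e = 1" using vector_choose_size[of 1] by auto
  define u where "u = (if v = 0 then e else sgn v)"
  have u: "norm u = 1" "norm v *\<^sub>R u = v"
    using e by (auto simp: u_def norm_sgn sgn_div_norm)
  have "hyp_line x u (2 * l) = y"
    using hyp_swap_hyp_swap[OF assms] by (simp add: hyp_line_def nv u v_def[symmetric])
  with u(1) that show thesis by (simp add: l_def)
qed

lemma hyp_line_C1:
  assumes "norm x < 1" "norm u = 1"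
  shows "\<exists>D. (\<forall>t. ((\<lambda>t. hyp_line x u (L * t)) has_vector_derivative D t) (at t)) \<and> continuous_on UNIV D"
proof -
  define A p where "A = (norm x)\<^sup>2" and "p = x \<bullet> u"
  define \<tau> where "\<tau> t = tanh (L * t / 2)" for t
  have \<tau>: "(\<tau> has_real_derivative (1 - (\<tau> t)\<^sup>2) * (L / 2)) (at t)" for t
    unfolding \<tau>_def by (auto intro!: derivative_eq_intros)
  have \<tau>c: "continuous_on UNIV \<tau>"
    using \<tau> by (meson DERIV_continuous continuous_at_imp_continuous_on)
  define d where "d t = 1 - 2 * (\<tau> t * p) + A * (\<tau> t)\<^sup>2" for t
  have d: "d t \<noteq> 0" for t
    using hyp_swap_denom_pos[OF assms(1) norm_tanh_scaleR[OF assms(2)], of "L * t / 2"] assms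
    by (simp add: d_def \<tau>_def A_def p_def)
  have eq: "hyp_line x u (L * t) = (1 / d t) *\<^sub>R
      ((1 - A) *\<^sub>R (x - \<tau> t *\<^sub>R u) + ((\<tau> t)\<^sup>2 - 2 * \<tau> t * p + A) *\<^sub>R x)" for t
  proof -
    have uu: "u \<bullet> u = 1" using assms(2) by (simp add: norm_eq_sqrt_inner)
    have n: "(norm (\<tau> t *\<^sub>R u))\<^sup>2 = (\<tau> t)\<^sup>2"
      using assms(2) by simp
    have "(norm (\<tau> t *\<^sub>R u - x))\<^sup>2 = (\<tau> t)\<^sup>2 * (u \<bullet> u) - 2 * \<tau> t * p + A"
      unfolding A_def p_def power2_norm_eq_inner
      by (simp add: inner_simps inner_commute power2_eq_square algebra_simps)
    then have m: "(norm (\<tau> t *\<^sub>R u - x))\<^sup>2 = (\<tau> t)\<^sup>2 - 2 * \<tau> t * p + A"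
      by (simp add: uu)
    show ?thesis
      unfolding hyp_line_def hyp_swap_def \<tau>_def[symmetric] n m d_def
      unfolding A_def[symmetric] p_def by (simp add: divide_inverse)
  qed
  define D where "D t = (1 / d t) *\<^sub>R (((1 - (\<tau> t)\<^sup>2) * (L / 2)) *\<^sub>R
        (- ((1 - A) *\<^sub>R u) + (2 * \<tau> t - 2 * p) *\<^sub>R x))
      + (- ((1 - (\<tau> t)\<^sup>2) * (L / 2)) * (2 * A * \<tau> t - 2 * p) / (d t)\<^sup>2) *\<^sub>R
          ((1 - A) *\<^sub>R (x - \<tau> t *\<^sub>R u) + ((\<tau> t)\<^sup>2 - 2 * \<tau> t * p + A) *\<^sub>R x)" for t
  have "((\<lambda>t. hyp_line x u (L * t)) has_vector_derivative D t) (at t)" for t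
  proof -
    define r where "r = (1 - (\<tau> t)\<^sup>2) * (L / 2)"
    have r: "(\<tau> has_real_derivative r) (at t)" using \<tau> by (simp add: r_def)
    have dd: "(d has_real_derivative r * (2 * A * \<tau> t - 2 * p)) (at t)"
      unfolding d_def by (rule derivative_eq_intros r refl)+ (simp add: algebra_simps)
    have 1: "((\<lambda>t. 1 / d t) has_real_derivative - r * (2 * A * \<tau> t - 2 * p) / (d t)\<^sup>2) (at t)"
    proof -
      have "((\<lambda>t. inverse (d t)) has_real_derivative - (inverse (d t) * (r * (2 * A * \<tau> t - 2 * p)) * inverse (d t))) (at t)"
        by (rule DERIV_inverse'[OF dd d])
      also have "- (inverse (d t) * (r * (2 * A * \<tau> t - 2 * p)) * inverse (d t)) = - r * (2 * A * \<tau> t - 2 * p) / (d t)\<^sup>2"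
        by (simp add: power2_eq_square divide_inverse mult_ac)
      finally show ?thesis by (simp add: inverse_eq_divide)
    qed
    have s: "((\<lambda>t. (\<tau> t)\<^sup>2 - 2 * \<tau> t * p + A) has_real_derivative r * (2 * \<tau> t - 2 * p)) (at t)"
      by (rule derivative_eq_intros r refl)+ (simp add: algebra_simps)
    have 2: "((\<lambda>t. (1 - A) *\<^sub>R (x - \<tau> t *\<^sub>R u) + ((\<tau> t)\<^sup>2 - 2 * \<tau> t * p + A) *\<^sub>R x)
       has_vector_derivative (1 - A) *\<^sub>R (0 - (\<tau> t *\<^sub>R 0 + r *\<^sub>R u))
          + ((((\<tau> t)\<^sup>2 - 2 * \<tau> t * p + A)) *\<^sub>R 0 + (r * (2 * \<tau> t - 2 * p)) *\<^sub>R x)) (at t)"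
      by (rule has_vector_derivative_add[OF
            bounded_linear.has_vector_derivative[OF bounded_linear_scaleR_right
              has_vector_derivative_diff[OF has_vector_derivative_const
                has_vector_derivative_scaleR[OF r has_vector_derivative_const]]]
            has_vector_derivative_scaleR[OF s has_vector_derivative_const]])
    have "B *\<^sub>R (0 - (b *\<^sub>R 0 + r *\<^sub>R u)) + (c *\<^sub>R 0 + (r * k) *\<^sub>R x)
        = r *\<^sub>R (- (B *\<^sub>R u) + k *\<^sub>R x)" for B b c k
      by (simp add: scaleR_add_right scaleR_diff_right mult.commute)
    note 2 = 2[unfolded this]
    show ?thesis
      unfolding eq D_def r_def[symmetric]
      by (rule has_vector_derivative_scaleR[OF 1 2])
  qed
  moreover have "continuous_on UNIV D"
    unfolding D_def d_def
    by (intro continuous_intros \<tau>c ballI) (use d in \<open>auto simp: d_def\<close>)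
  ultimately show ?thesis by blast
qed

text \<open>The speed is found without differentiating \<open>hyp_swap\<close>: the norm of the derivative is the limit of
  the difference quotients, and \<open>hyp_quot_hyp_line\<close> gives the Euclidean distance of two points of the
  line exactly.\<close>

lemma hyp_speed_hyp_line:
  assumes "norm x < 1" "norm u = 1" "0 \<le> L" "t \<in> {0..1}"
  shows "hyp_speed (\<lambda>t. hyp_line x u (L * t)) t = L"
proof -
  define \<gamma> where "\<gamma> = (\<lambda>t. hyp_line x u (L * t))"
  obtain v where v: "(\<gamma> has_vector_derivative v) (at t)"
    using hyp_line_C1[OF assms(1,2), of L] by (auto simp: \<gamma>_def)
  have ball: "norm (\<gamma> s) < 1" for s
    unfolding \<gamma>_def by (rule norm_hyp_line[OF assms(1,2)])
  have cont: "isCont \<gamma> t"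
    using v by (rule has_vector_derivative_continuous)
  define w where "w s = 1 - (norm (\<gamma> s))\<^sup>2" for s
  have w: "w s > 0" for s unfolding w_def by (rule one_minus_norm_sq_pos[OF ball])
  have dist: "norm (\<gamma> s - \<gamma> t) = sinh (L * (s - t) / 2) * sqrt (w s * w t)" if "s > t" for s
  proof -
    have "hyp_quot (\<gamma> s) (\<gamma> t) = (sinh (L * (s - t) / 2))\<^sup>2"
      unfolding \<gamma>_def hyp_quot_hyp_line[OF assms(1,2)] by (simp add: algebra_simps)
    then have "(norm (\<gamma> s - \<gamma> t))\<^sup>2 = (sinh (L * (s - t) / 2))\<^sup>2 * (w s * w t)"
      using w[of s] w[of t] by (simp add: hyp_quot_def w_def[symmetric] field_simps)
    then have "sqrt ((norm (\<gamma> s - \<gamma> t))\<^sup>2) = sqrt ((sinh (L * (s - t) / 2))\<^sup>2 * (w s * w t))"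
      by simp
    then show ?thesis
      using that assms(3) by (simp add: real_sqrt_mult)
  qed
  have lim1: "((\<lambda>s. norm ((1 / (s - t)) *\<^sub>R (\<gamma> s - \<gamma> t))) \<longlongrightarrow> norm v) (at_right t)"
  proof (rule tendsto_norm)
    have "(\<gamma> has_derivative (\<lambda>h. h *\<^sub>R v)) (at t within {t<..})"
      using v has_derivative_at_withinI unfolding has_vector_derivative_def by blast
    then have "((\<lambda>s. (1 / norm (s - t)) *\<^sub>R (\<gamma> s - (\<gamma> t + (s - t) *\<^sub>R v))) \<longlongrightarrow> 0) (at_right t)"
      unfolding has_derivative_within by blast
    from tendsto_add[OF this tendsto_const[of v]]
    have lim: "((\<lambda>s. (1 / norm (s - t)) *\<^sub>R (\<gamma> s - (\<gamma> t + (s - t) *\<^sub>R v)) + v) \<longlongrightarrow> v) (at_right t)"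
      by simp
    have "eventually (\<lambda>s. (1 / norm (s - t)) *\<^sub>R (\<gamma> s - (\<gamma> t + (s - t) *\<^sub>R v)) + v
          = (1 / (s - t)) *\<^sub>R (\<gamma> s - \<gamma> t)) (at_right t)"
      using eventually_at_right_less[of t]
    proof eventually_elim
      case (elim s)
      then have "(1 / (s - t)) *\<^sub>R (y - (z + (s - t) *\<^sub>R w)) + w = (1 / (s - t)) *\<^sub>R (y - z)" for y z w :: 'a
        by (simp only: diff_diff_add[symmetric] scaleR_diff_right[of _ "y - z"] scaleR_scaleR) simp
      with elim show ?case by simp
    qed
    with lim show "((\<lambda>s. (1 / (s - t)) *\<^sub>R (\<gamma> s - \<gamma> t)) \<longlongrightarrow> v) (at_right t)"
      by (rule Lim_transform_eventually)
  qed
  have lim2: "((\<lambda>s. sinh (L * (s - t) / 2) / (s - t) * sqrt (w s * w t)) \<longlongrightarrow> L / 2 * sqrt (w t * w t)) (at_right t)"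
  proof (rule tendsto_mult)
    have "((\<lambda>s. L * (s - t) / 2) has_real_derivative L / 2) (at t within {t<..})"
      by (rule DERIV_cong[OF DERIV_cdivide[OF DERIV_cmult[OF DERIV_diff[OF DERIV_ident DERIV_const]]]]) simp
    then have "((\<lambda>s. sinh (L * (s - t) / 2)) has_real_derivative cosh (L * (t - t) / 2) * (L / 2)) (at t within {t<..})"
      by (rule has_field_derivative_sinh)
    then show "((\<lambda>s. sinh (L * (s - t) / 2) / (s - t)) \<longlongrightarrow> L / 2) (at_right t)"
      unfolding has_field_derivative_iff by simp
    have "(\<gamma> \<longlongrightarrow> \<gamma> t) (at_right t)"
      using cont unfolding isCont_def by (rule tendsto_within_subset) simp
    then have "(w \<longlongrightarrow> w t) (at_right t)"
      unfolding w_def by (intro tendsto_intros)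
    then show "((\<lambda>s. sqrt (w s * w t)) \<longlongrightarrow> sqrt (w t * w t)) (at_right t)"
      by (intro tendsto_intros)
  qed
  have ev: "eventually (\<lambda>s. sinh (L * (s - t) / 2) / (s - t) * sqrt (w s * w t)
      = norm ((1 / (s - t)) *\<^sub>R (\<gamma> s - \<gamma> t))) (at_right t)"
    using eventually_at_right_less[of t] by eventually_elim (simp add: dist)
  have "norm v = L / 2 * sqrt (w t * w t)"
    by (rule tendsto_unique[OF trivial_limit_at_right_real lim1 Lim_transform_eventually[OF lim2 ev]])
  then have "2 * norm v / w t = L"
    using w[of t] by (simp add: field_simps)
  moreover have "vector_derivative \<gamma> (at t within {0..1}) = v"
    using v assms(4) by (intro vector_derivative_at_within_ivl) auto
  ultimately show ?thesis
    by (simp add: hyp_speed_def w_def \<gamma>_def[symmetric])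
qed

theorem hyp_dist_eq:
  assumes "norm x < 1" "norm (y::'a::euclidean_space) < 1"
  shows "hyp_dist x y = 2 * arsinh (sqrt (hyp_quot x y))"
proof -
  define L where "L = 2 * arsinh (sqrt (hyp_quot x y))"
  have L: "0 \<le> L" using hyp_quot_nonneg[OF assms] by (simp add: L_def arsinh_real_nonneg)
  obtain u where u: "norm u = 1" "hyp_line x u L = y"
    using ex_hyp_line[OF assms] by (auto simp: L_def)
  define \<gamma> where "\<gamma> = (\<lambda>t. hyp_line x u (L * t))"
  have sp: "hyp_speed \<gamma> t = L" if "t \<in> {0..1}" for t
    unfolding \<gamma>_def by (rule hyp_speed_hyp_line[OF assms(1) u(1) L that])
  have I: "(hyp_speed \<gamma> has_integral L) {0..1}"
    using has_integral_const_real[of L 0 1]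
    by (intro has_integral_eq[of "{0..1}" "\<lambda>_. L" "hyp_speed \<gamma>" L]) (simp_all add: sp)
  obtain D where "\<And>t. (\<gamma> has_vector_derivative D t) (at t)" "continuous_on UNIV D"
    using hyp_line_C1[OF assms(1) u(1), of L] unfolding \<gamma>_def by auto
  then have "\<gamma> C1_differentiable_on {0..1}"
    unfolding C1_differentiable_on_def by (intro exI[of _ D]) (auto intro: continuous_on_subset)
  then have vp: "valid_path \<gamma>"
    by (simp add: valid_path_def C1_differentiable_imp_piecewise)
  have ends: "pathstart \<gamma> = x" "pathfinish \<gamma> = y"
    using u by (simp_all add: \<gamma>_def pathstart_def pathfinish_def hyp_line_def)
  have im: "path_image \<gamma> \<subseteq> ball 0 1"
    using norm_hyp_line[OF assms(1) u(1)] by (auto simp: \<gamma>_def path_image_def)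
  have "hyp_length \<gamma> = L"
    using I by (simp add: hyp_length_def integral_unique)
  then have "L \<in> {hyp_length \<gamma> | \<gamma>. valid_path \<gamma> \<and> path_image \<gamma> \<subseteq> ball 0 1 \<and>
     pathstart \<gamma> = x \<and> pathfinish \<gamma> = y \<and> hyp_speed \<gamma> integrable_on {0..1}}"
    using vp im ends I by blast
  then show ?thesis
    unfolding hyp_dist_def L_def[symmetric]
    by (rule cInf_eq_minimum) (use hyp_length_ge in \<open>auto simp: L_def\<close>)
qed

lemma ex_hyp_geodesic_segment:
  assumes "norm x < 1" "norm (y::'a::euclidean_space) < 1"
  shows "\<exists>S. hyp_geodesic_segment (hyp_dist x y) x y S"
proof -
  define L where "L = hyp_dist x y"
  have L: "0 \<le> L" using hyp_quot_nonneg[OF assms] by (simp add: L_def hyp_dist_eq assms arsinh_real_nonneg)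
  obtain u where u: "norm u = 1" "hyp_line x u L = y"
    using ex_hyp_line[OF assms] by (auto simp: L_def hyp_dist_eq assms)
  have "hyp_dist (hyp_line x u s) (hyp_line x u t) = \<bar>s - t\<bar>" for s t
  proof -
    have "hyp_dist (hyp_line x u s) (hyp_line x u t) = 2 * arsinh \<bar>sinh ((s - t) / 2)\<bar>"
      by (simp add: hyp_dist_eq norm_hyp_line assms u hyp_quot_hyp_line)
    also have "\<bar>sinh ((s - t) / 2)\<bar> = sinh \<bar>(s - t) / 2\<bar>"
      by (cases "s \<ge> t") (auto simp: abs_if)
    finally show ?thesis by (simp add: arsinh_sinh_real)
  qed
  then have "hyp_geodesic_segment L x y (hyp_line x u ` {0..L})"
    unfolding hyp_geodesic_segment_def using L u norm_hyp_line[OF assms(1) u(1)]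
    by (intro conjI exI[of _ "hyp_line x u"]) (auto simp: hyp_line_def)
  then show ?thesis by (auto simp: L_def)
qed

section \<open>Equilateral triangles and bounded skew\<close>

lemma ex_equilateral_hyp_triangle:
  fixes p q w :: "'a::euclidean_space"
  assumes ball: "norm p < 1" "norm q < 1" "norm w < 1" and ne: "p \<noteq> q"
    and eq: "hyp_quot p q = hyp_quot q w" "hyp_quot p q = hyp_quot p w"
  shows "\<exists>T. equilateral_hyp_triangle T \<and> vertex T 1 = p \<and> vertex T 2 = q \<and> vertex T 3 = w"
proof -
  define v :: "3 \<Rightarrow> 'a" where "v i = (if i = 1 then p else if i = 2 then q else w)" for i
  have v: "v 1 = p" "v 2 = q" "v 3 = w" by (simp_all add: v_def)
  define L where "L = hyp_dist p q"
  have pos: "0 < hyp_quot p q"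
    using hyp_quot_nonneg[OF ball(1,2)] hyp_quot_eq_0_iff[OF ball(1,2)] ne by linarith
  have nv: "norm (v i) < 1" for i using ball by (simp add: v_def)
  have "\<forall>i j. i \<noteq> j \<longrightarrow> hyp_quot (v i) (v j) = hyp_quot p q"
    unfolding forall_3 v using eq by (simp add: hyp_quot_commute)
  then have quot: "hyp_quot (v i) (v j) = hyp_quot p q" if "i \<noteq> j" for i j using that by blast
  have "inj v"
  proof (rule injI, rule ccontr)
    fix i j assume "v i = v j" "i \<noteq> j"
    then have "hyp_quot (v i) (v i) = hyp_quot p q" using quot[of i j] by simp
    moreover have "hyp_quot (v i) (v i) = 0" by (simp add: hyp_quot_def)
    ultimately show False using pos by simp
  qed
  moreover have "\<exists>S. hyp_geodesic_segment L (v (i + 1)) (v (i + 2)) S" for i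
  proof -
    have "i + 1 \<noteq> i + 2" by simp
    then have "hyp_dist (v (i + 1)) (v (i + 2)) = L"
      by (simp add: L_def hyp_dist_eq nv ball quot)
    then show ?thesis
      using ex_hyp_geodesic_segment[OF nv[of "i + 1"] nv[of "i + 2"]] by simp
  qed
  then obtain e where "\<And>i. hyp_geodesic_segment L (v (i + 1)) (v (i + 2)) (e i)" by metis
  ultimately have "equilateral_hyp_triangle (Triangle v e)"
    by (auto simp: equilateral_hyp_triangle_def)
  then show ?thesis using v by (metis triangle.sel(1))
qed

text \<open>Equality of the three values of \<open>hyp_quot\<close> expresses that \<open>p\<close>, \<open>q\<close>, \<open>w\<close> are equidistant. The
  degenerate case \<open>p = q = w\<close> is allowed, which spares case distinctions when vertices are
  constructed.\<close>

definition equilateral_skew_bounded :: "real \<Rightarrow> ('a::euclidean_space \<Rightarrow> 'a) \<Rightarrow> bool" where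
  "equilateral_skew_bounded \<sigma> f \<longleftrightarrow>
     (\<forall>p q w. norm p < 1 \<longrightarrow> norm q < 1 \<longrightarrow> norm w < 1 \<longrightarrow>
        hyp_quot p q = hyp_quot q w \<longrightarrow> hyp_quot p q = hyp_quot p w \<longrightarrow>
        hyp_dist (f p) (f w) \<le> \<sigma> * hyp_dist (f p) (f q))"

lemma hyp_dist_pos:
  assumes "norm x < 1" "norm (y::'a::euclidean_space) < 1" "x \<noteq> y"
  shows "0 < hyp_dist x y"
  using hyp_quot_nonneg[OF assms(1,2)] hyp_quot_eq_0_iff[OF assms(1,2)] assms(3)
  by (simp add: hyp_dist_eq assms)

lemma equilateral_skew_boundedI:
  fixes f :: "'a::euclidean_space \<Rightarrow> 'a"
  assumes inj: "inj_on f (ball 0 1)" and im: "f ` ball 0 1 \<subseteq> ball 0 1"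
    and skew: "\<And>T. equilateral_hyp_triangle T \<Longrightarrow> hyp_skew (triangle_image f T) \<le> \<sigma>"
  shows "equilateral_skew_bounded \<sigma> f"
  unfolding equilateral_skew_bounded_def
proof (intro allI impI)
  fix p q w :: 'a
  assume ball: "norm p < 1" "norm q < 1" "norm w < 1"
    and eq: "hyp_quot p q = hyp_quot q w" "hyp_quot p q = hyp_quot p w"
  show "hyp_dist (f p) (f w) \<le> \<sigma> * hyp_dist (f p) (f q)"
  proof (cases "p = q")
    case True
    then have "hyp_quot p w = 0" using eq(2) by (simp add: hyp_quot_def)
    then have "w = p" using hyp_quot_eq_0_iff[OF ball(1,3)] by simp
    moreover have "hyp_dist (f p) (f p) = 0"
      using ball im by (subst hyp_dist_eq) (force simp: hyp_quot_def)+
    ultimately show ?thesis using True by simp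
  next
    case False
    then obtain T where T: "equilateral_hyp_triangle T" "vertex T 1 = p" "vertex T 2 = q" "vertex T 3 = w"
      using ex_equilateral_hyp_triangle[OF ball False eq] by blast
    define v where "v = vertex T"
    have v: "v 1 = p" "v 2 = q" "v 3 = w" using T by (simp_all add: v_def)
    have injv: "inj v" using T by (simp add: equilateral_hyp_triangle_def v_def)
    have "\<forall>i. norm (v i) < 1" unfolding forall_3 v using ball by simp
    then have nv: "v i \<in> ball 0 1" for i by simp
    define D where "D = {hyp_dist (f (v i)) (f (v j)) | i j. i \<noteq> j}"
    have "D \<subseteq> (\<lambda>(i, j). hyp_dist (f (v i)) (f (v j))) ` UNIV" by (auto simp: D_def)
    then have fin: "finite D" by (rule finite_subset) simp
    have in1: "hyp_dist (f p) (f w) \<in> D" and in2: "hyp_dist (f p) (f q) \<in> D"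
    proof -
      have "(1::3) \<noteq> 3" "(1::3) \<noteq> 2" by simp_all
      then show "hyp_dist (f p) (f w) \<in> D" "hyp_dist (f p) (f q) \<in> D"
        unfolding D_def v[symmetric] by blast+
    qed
    have pos: "0 < d" if "d \<in> D" for d
    proof -
      obtain i j where ij: "d = hyp_dist (f (v i)) (f (v j))" "i \<noteq> j"
        using \<open>d \<in> D\<close> by (auto simp: D_def)
      then have "f (v i) \<noteq> f (v j)"
        using inj_onD[OF inj _ nv nv] injD[OF injv] by blast
      moreover have "norm (f (v k)) < 1" for k using im nv[of k] by force
      ultimately show ?thesis unfolding ij by (intro hyp_dist_pos)
    qed
    have minpos: "0 < Min D" using pos Min_in[OF fin] in1 by blast
    have "hyp_skew (triangle_image f T) = Max D / Min D"
      by (simp add: hyp_skew_def triangle_image_def D_def v_def)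
    then have le: "Max D \<le> \<sigma> * Min D"
      using skew[OF T(1)] minpos by (simp add: divide_le_eq)
    have "0 < Max D" using pos Max_in[OF fin] in1 by blast
    then have "0 < \<sigma>" using le minpos by (metis less_le_trans zero_less_mult_pos2)
    have "hyp_dist (f p) (f w) \<le> Max D" using fin in1 by simp
    also have "\<dots> \<le> \<sigma> * Min D" by (rule le)
    also have "\<dots> \<le> \<sigma> * hyp_dist (f p) (f q)"
      using \<open>0 < \<sigma>\<close> fin in2 by simp
    finally show ?thesis .
  qed
qed

lemma equilateral_skew_bounded_conj:
  fixes f :: "'a::euclidean_space \<Rightarrow> 'a"
  assumes f: "equilateral_skew_bounded \<sigma> f" and im: "f ` ball 0 1 \<subseteq> ball 0 1"
    and ab: "norm a < 1" "norm b < 1"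
  shows "equilateral_skew_bounded \<sigma> (\<lambda>x. hyp_swap b (f (hyp_swap a x)))"
  unfolding equilateral_skew_bounded_def
proof (intro allI impI)
  fix p q w :: 'a
  assume ball: "norm p < 1" "norm q < 1" "norm w < 1"
    and eq: "hyp_quot p q = hyp_quot q w" "hyp_quot p q = hyp_quot p w"
  have fb: "norm (f (hyp_swap a x)) < 1" if "norm x < 1" for x
    using im norm_hyp_swap_less_1[OF ab(1) that] by force
  have dist: "hyp_dist (hyp_swap b (f (hyp_swap a x))) (hyp_swap b (f (hyp_swap a y)))
      = hyp_dist (f (hyp_swap a x)) (f (hyp_swap a y))" if "norm x < 1" "norm y < 1" for x y
    using that by (simp add: hyp_dist_eq norm_hyp_swap_less_1 fb ab hyp_quot_hyp_swap)
  show "hyp_dist (hyp_swap b (f (hyp_swap a p))) (hyp_swap b (f (hyp_swap a w)))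
      \<le> \<sigma> * hyp_dist (hyp_swap b (f (hyp_swap a p))) (hyp_swap b (f (hyp_swap a q)))"
    unfolding dist[OF ball(1,3)] dist[OF ball(1,2)]
    using f ball eq ab by (simp add: equilateral_skew_bounded_def norm_hyp_swap_less_1 hyp_quot_hyp_swap)
qed

lemma arsinh_real_le: "0 \<le> t \<Longrightarrow> arsinh t \<le> (t::real)"
proof -
  assume t: "0 \<le> t"
  have "sqrt (t\<^sup>2 + 1) \<le> 1 + t\<^sup>2 / 2"
    by (rule real_le_lsqrt) (use t in \<open>auto simp: power2_eq_square algebra_simps\<close>)
  then have "t + sqrt (t\<^sup>2 + 1) \<le> exp t"
    using exp_lower_Taylor_quadratic[OF t] by linarith
  then show ?thesis
    unfolding arsinh_real_def using arsinh_real_aux[of t] by (metis exp_gt_zero ln_exp ln_le_cancel_iff)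
qed

lemma arsinh_real_ge: "0 \<le> t \<Longrightarrow> t / (1 + t) \<le> arsinh (t::real)"
proof -
  assume t: "0 \<le> t"
  have "t / (1 + t) = - (1 / (1 + t) - 1)" using t by (simp add: field_simps)
  also have "\<dots> \<le> - ln (1 / (1 + t))" using ln_le_minus_one[of "1 / (1 + t)"] t by simp
  also have "\<dots> = ln (1 + t)" using t by (simp add: ln_div)
  also have "\<dots> \<le> ln (t + sqrt (t\<^sup>2 + 1))"
    using t real_le_rsqrt[of 1 "t\<^sup>2 + 1"] arsinh_real_aux[of t] by (subst ln_le_cancel_iff) auto
  finally show ?thesis by (simp add: arsinh_real_def)
qed

lemma hyp_dist_euclidean_bounds:
  assumes "norm x \<le> 1 / 2" "norm (y::'a::euclidean_space) \<le> 1 / 2"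
  shows "norm (x - y) / 2 \<le> hyp_dist x y" and "hyp_dist x y \<le> 3 * norm (x - y)"
proof -
  have sq: "3 / 4 \<le> 1 - (norm x)\<^sup>2" "3 / 4 \<le> 1 - (norm y)\<^sup>2" "1 - (norm x)\<^sup>2 \<le> 1" "1 - (norm y)\<^sup>2 \<le> 1"
    using power_mono[OF assms(1), of 2] power_mono[OF assms(2), of 2] by (auto simp: power2_eq_square)
  define P where "P = (1 - (norm x)\<^sup>2) * (1 - (norm y)\<^sup>2)"
  have P: "(3/4)\<^sup>2 \<le> P" "P \<le> 1"
    unfolding P_def power2_eq_square[of "3/4"] using sq by (intro mult_mono mult_le_one; simp)+
  then have sP: "3 / 4 \<le> sqrt P" "sqrt P \<le> 1"
    using real_le_rsqrt[OF P(1)] by auto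
  define t where "t = sqrt (hyp_quot x y)"
  have t: "t = norm (x - y) / sqrt P"
    by (simp add: t_def hyp_quot_def P_def real_sqrt_divide)
  have d: "hyp_dist x y = 2 * arsinh t"
    using assms by (simp add: hyp_dist_eq t_def)
  have n: "norm (x - y) \<le> 1" using norm_triangle_ineq4[of x y] assms by linarith
  have t1: "norm (x - y) \<le> t" "t \<le> 4 / 3 * norm (x - y)" "0 \<le> t"
  proof -
    have spos: "0 < sqrt P" using sP by linarith
    have "norm (x - y) * sqrt P \<le> norm (x - y) * 1" using sP by (intro mult_left_mono) auto
    then show "norm (x - y) \<le> t" unfolding t pos_le_divide_eq[OF spos] by simp
    have "norm (x - y) * (3/4) \<le> norm (x - y) * sqrt P" using sP by (intro mult_left_mono) auto
    then show "t \<le> 4 / 3 * norm (x - y)" unfolding t pos_divide_le_eq[OF spos] by simp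
    show "0 \<le> t" unfolding t using spos by simp
  qed
  show "hyp_dist x y \<le> 3 * norm (x - y)"
    using arsinh_real_le[OF t1(3)] t1 norm_ge_zero[of "x - y"] unfolding d by linarith
  have "t / 4 \<le> t / (1 + t)"
    using t1 n by (intro divide_left_mono) auto
  then show "norm (x - y) / 2 \<le> hyp_dist x y"
    using arsinh_real_ge[OF t1(3)] t1 unfolding d by linarith
qed

text \<open>Near \<open>0\<close> the hyperbolic and the Euclidean distance are comparable with absolute constants, so the
  skew bound turns into a bound for the image of one vertex in terms of those of the two others.
  Only the radius \<open>R\<close> depends on \<open>F\<close>.\<close>

lemma equilateral_skew_bounded_near_0:
  fixes F :: "'a::euclidean_space \<Rightarrow> 'a"
  assumes F: "equilateral_skew_bounded \<sigma> F" and \<sigma>: "1 \<le> \<sigma>"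
    and cont: "continuous_on (ball 0 1) F" and F0: "F 0 = 0"
  obtains R where "0 < R" "R \<le> 1"
    "\<And>p q w. norm p < R \<Longrightarrow> norm q < R \<Longrightarrow> norm w < R \<Longrightarrow> hyp_quot p q = hyp_quot q w \<Longrightarrow>
        hyp_quot p q = hyp_quot p w \<Longrightarrow>
        norm (F w) \<le> (1 + 12 * \<sigma>) * max (norm (F p)) (norm (F q))"
proof -
  have "isCont F 0" using cont by (simp add: continuous_on_eq_continuous_at)
  then obtain d where d: "d > 0" "\<And>x. dist x 0 < d \<Longrightarrow> dist (F x) (F 0) < 1 / 2"
    unfolding continuous_at_eps_delta by (metis half_gt_zero_iff zero_less_one)
  show thesis
  proof (rule that)
    show "0 < min d 1" "min d 1 \<le> 1" using d by auto
  next
    fix p q w :: 'a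
    assume R: "norm p < min d 1" "norm q < min d 1" "norm w < min d 1"
      and eq: "hyp_quot p q = hyp_quot q w" "hyp_quot p q = hyp_quot p w"
    have sm: "norm (F p) \<le> 1/2" "norm (F q) \<le> 1/2" "norm (F w) \<le> 1/2"
      using d(2)[of p] d(2)[of q] d(2)[of w] R F0 by auto
    have "hyp_dist (F p) (F w) \<le> \<sigma> * hyp_dist (F p) (F q)"
      using F R eq by (simp add: equilateral_skew_bounded_def)
    also have "\<dots> \<le> \<sigma> * (3 * norm (F p - F q))"
      using \<sigma> hyp_dist_euclidean_bounds(2)[OF sm(1,2)] by (intro mult_left_mono) auto
    finally have "norm (F p - F w) \<le> 6 * \<sigma> * norm (F p - F q)"
      using hyp_dist_euclidean_bounds(1)[OF sm(1,3)] by simp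
    also have "\<dots> \<le> 6 * \<sigma> * (2 * max (norm (F p)) (norm (F q)))"
      using \<sigma> norm_triangle_ineq4[of "F p" "F q"] by (intro mult_left_mono) auto
    finally show "norm (F w) \<le> (1 + 12 * \<sigma>) * max (norm (F p)) (norm (F q))"
      using norm_triangle_ineq2[of "F w" "F p"] norm_minus_commute[of "F p" "F w"]
      by (simp add: algebra_simps)
  qed
qed

section \<open>The third vertex of an equilateral triangle in the disc\<close>

text \<open>Near \<open>0\<close> the involution is the point reflection \<open>x \<mapsto> p - x\<close> up to third order.\<close>

lemma hyp_swap_approx:
  fixes p x :: "'a::euclidean_space"
  assumes "norm p \<le> \<rho>" "norm x \<le> \<rho>" "\<rho> \<le> 1 / 2"
  shows "norm (hyp_swap p x - (p - x)) \<le> 24 * \<rho> ^ 3"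
proof -
  have \<rho>: "0 \<le> \<rho>" using assms(1) norm_ge_zero order_trans by blast
  have r2: "\<rho> ^ 2 \<le> 1 / 4" using power_mono[OF assms(3) \<rho>, of 2] by (simp add: power2_eq_square)
  define D where "D = 1 - 2 * (p \<bullet> x) + (norm p)\<^sup>2 * (norm x)\<^sup>2"
  define c where "c = 2 * (p \<bullet> x) - (norm p)\<^sup>2 - (norm p)\<^sup>2 * (norm x)\<^sup>2"
  have ip: "\<bar>p \<bullet> x\<bar> \<le> \<rho> ^ 2"
    using Cauchy_Schwarz_ineq2[of p x] mult_mono[OF assms(1,2) \<rho> norm_ge_zero]
    by (simp add: power2_eq_square)
  have P: "(norm p)\<^sup>2 \<le> \<rho>\<^sup>2" "(norm x)\<^sup>2 \<le> \<rho>\<^sup>2"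
    using assms by (auto intro: power_mono)
  then have PX: "(norm p)\<^sup>2 * (norm x)\<^sup>2 \<le> \<rho>\<^sup>2 * 1"
    using r2 by (intro mult_mono) auto
  have nn: "0 \<le> (norm p)\<^sup>2 * (norm x)\<^sup>2" "0 \<le> (norm p)\<^sup>2" by simp_all
  have D: "1 / 2 \<le> D"
    unfolding D_def using ip r2 nn by linarith
  have c: "\<bar>c\<bar> \<le> 4 * \<rho>\<^sup>2"
    unfolding c_def using ip P PX nn by linarith
  have "D *\<^sub>R (hyp_swap p x - (p - x)) = (1 - (norm p)\<^sup>2) *\<^sub>R (p - x) + (norm (x - p))\<^sup>2 *\<^sub>R p - D *\<^sub>R (p - x)"
    using D unfolding hyp_swap_def D_def[symmetric] by (simp add: scaleR_diff_right)
  also have "\<dots> = c *\<^sub>R (p - x) + (norm (x - p))\<^sup>2 *\<^sub>R p"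
    by (simp add: D_def c_def algebra_simps)
  finally have eq: "D *\<^sub>R (hyp_swap p x - (p - x)) = c *\<^sub>R (p - x) + (norm (x - p))\<^sup>2 *\<^sub>R p" .
  have "D * norm (hyp_swap p x - (p - x)) = norm (c *\<^sub>R (p - x) + (norm (x - p))\<^sup>2 *\<^sub>R p)"
    unfolding eq[symmetric] using D by simp
  also have "\<dots> \<le> \<bar>c\<bar> * norm (p - x) + (norm (x - p))\<^sup>2 * norm p"
    using norm_triangle_ineq[of "c *\<^sub>R (p - x)" "(norm (x - p))\<^sup>2 *\<^sub>R p"] by simp
  also have "\<dots> \<le> (4 * \<rho>\<^sup>2) * (2 * \<rho>) + (2 * \<rho>)\<^sup>2 * \<rho>"
    using c assms \<rho> norm_triangle_ineq4[of p x] norm_triangle_ineq4[of x p]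
    by (intro add_mono mult_mono power_mono) auto
  also have "\<dots> = 12 * \<rho> ^ 3" by (simp add: power2_eq_square power3_eq_cube)
  finally have "D * norm (hyp_swap p x - (p - x)) \<le> 12 * \<rho> ^ 3" .
  moreover have "1 / 2 * norm (hyp_swap p x - (p - x)) \<le> D * norm (hyp_swap p x - (p - x))"
    using D by (intro mult_right_mono) auto
  ultimately show ?thesis by simp
qed

text \<open>The cosine of the angle of an equilateral triangle with vertices \<open>0\<close>, \<open>u\<close>, \<open>v\<close> where
  \<open>norm u = norm v = t\<close>: equating \<open>hyp_quot u v\<close> and \<open>hyp_quot 0 u\<close> gives
  \<open>2 - 2 * cos \<theta> = 1 - t\<^sup>2\<close>.\<close>

definition equilateral_cos :: "real \<Rightarrow> real" where
  "equilateral_cos t = (1 + t\<^sup>2) / 2"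

definition equilateral_rot :: "real \<Rightarrow> complex" where
  "equilateral_rot t = Complex (equilateral_cos t) (sqrt (1 - (equilateral_cos t)\<^sup>2))"

text \<open>The isometry \<open>hyp_swap p\<close> moves \<open>p\<close> to \<open>0\<close>, where the triangle is completed by a rotation, and
  then moves the new vertex back. Always rotating in the same sense makes the construction continuous
  in both arguments.\<close>

definition third_vertex :: "complex \<Rightarrow> complex \<Rightarrow> complex" where
  "third_vertex p q = hyp_swap p (equilateral_rot (norm (hyp_swap p q)) * hyp_swap p q)"

definition \<zeta> :: complex where "\<zeta> = Complex (1 / 2) (sqrt 3 / 2)"

lemma equilateral_cos_bounds:
  assumes "0 \<le> t" "t < 1"
  shows "1 / 2 \<le> equilateral_cos t" "equilateral_cos t < 1" "(equilateral_cos t)\<^sup>2 < 1"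
proof -
  have "t\<^sup>2 < 1" using assms by (simp add: abs_square_less_1)
  then show "1 / 2 \<le> equilateral_cos t" "equilateral_cos t < 1" by (auto simp: equilateral_cos_def)
  then show "(equilateral_cos t)\<^sup>2 < 1" by (simp add: abs_square_less_1)
qed

lemma norm_equilateral_rot:
  assumes "0 \<le> t" "t < 1"
  shows "norm (equilateral_rot t) = 1"
  using equilateral_cos_bounds[OF assms] by (simp add: equilateral_rot_def cmod_def)

lemma norm_one_minus_equilateral_rot:
  assumes "0 \<le> t" "t < 1"
  shows "(norm (1 - equilateral_rot t))\<^sup>2 = 1 - t\<^sup>2"
proof -
  have "(norm (1 - equilateral_rot t))\<^sup>2 = (1 - equilateral_cos t)\<^sup>2 + (1 - (equilateral_cos t)\<^sup>2)"
    unfolding cmod_power2 using equilateral_cos_bounds[OF assms] by (simp add: equilateral_rot_def)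
  also have "\<dots> = 1 - t\<^sup>2"
    by (simp add: equilateral_cos_def power2_eq_square field_simps)
  finally show ?thesis .
qed

lemma third_vertex:
  assumes "norm p < 1" "norm q < 1"
  shows "norm (third_vertex p q) < 1"
    and "hyp_quot p (third_vertex p q) = hyp_quot p q"
    and "hyp_quot q (third_vertex p q) = hyp_quot p q"
proof -
  define u where "u = hyp_swap p q"
  define k where "k = equilateral_rot (norm u)"
  have u: "norm u < 1" using norm_hyp_swap_less_1[OF assms] by (simp add: u_def)
  have k: "norm k = 1" "(norm (1 - k))\<^sup>2 = 1 - (norm u)\<^sup>2"
    using norm_equilateral_rot norm_one_minus_equilateral_rot u by (simp_all add: k_def)
  have ku: "norm (k * u) < 1" "norm (k * u) = norm u" using k u by (simp_all add: norm_mult)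
  have W: "third_vertex p q = hyp_swap p (k * u)" by (simp add: third_vertex_def u_def k_def)
  show "norm (third_vertex p q) < 1"
    unfolding W by (rule norm_hyp_swap_less_1[OF assms(1) ku(1)])
  have p: "p = hyp_swap p 0" and q: "q = hyp_swap p u"
    using hyp_swap_hyp_swap[OF assms] by (simp_all add: u_def)
  have pq: "hyp_quot p q = hyp_quot 0 u"
    using hyp_quot_hyp_swap[OF assms(1) _ u, of 0] by (simp flip: q)
  show "hyp_quot p (third_vertex p q) = hyp_quot p q"
    using hyp_quot_hyp_swap[OF assms(1) _ ku(1), of 0] unfolding W pq
    by (simp add: hyp_quot_def ku(2))
  have "hyp_quot q (third_vertex p q) = hyp_quot u (k * u)"
    unfolding W by (subst q) (rule hyp_quot_hyp_swap[OF assms(1) u ku(1)])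
  also have "norm (u - k * u) = norm (1 - k) * norm u"
    by (metis mult_1 norm_mult left_diff_distrib)
  then have "hyp_quot u (k * u) = hyp_quot 0 u"
    using one_minus_norm_sq_pos[OF u]
    by (simp add: hyp_quot_def ku(2) power_mult_distrib k(2))
  finally show "hyp_quot q (third_vertex p q) = hyp_quot p q" by (simp add: pq)
qed

lemma continuous_on_third_vertex:
  fixes f g :: "'b::topological_space \<Rightarrow> complex"
  assumes "continuous_on S f" "continuous_on S g"
    and "\<And>s. s \<in> S \<Longrightarrow> norm (f s) < 1" "\<And>s. s \<in> S \<Longrightarrow> norm (g s) < 1"
  shows "continuous_on S (\<lambda>s. third_vertex (f s) (g s))"
proof -
  have u: "norm (hyp_swap (f s) (g s)) < 1" if "s \<in> S" for s
    using assms(3,4) that norm_hyp_swap_less_1 by blast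
  have c: "continuous_on S (\<lambda>s. hyp_swap (f s) (g s))"
    using assms by (rule continuous_on_hyp_swap)
  then have "continuous_on S (\<lambda>s. equilateral_rot (norm (hyp_swap (f s) (g s))))"
    unfolding equilateral_rot_def equilateral_cos_def Complex_eq by (intro continuous_intros) auto
  then show ?thesis
    unfolding third_vertex_def
    using assms c u norm_equilateral_rot
    by (intro continuous_on_hyp_swap continuous_on_mult) (auto simp: norm_mult)
qed

lemma equilateral_rot_approx:
  assumes "0 \<le> t" "t < 1"
  shows "norm (equilateral_rot t - \<zeta>) \<le> 2 * t\<^sup>2"
proof -
  define c where "c = equilateral_cos t"
  have c: "1 / 2 \<le> c" "c < 1" "c\<^sup>2 < 1" "c - 1 / 2 = t\<^sup>2 / 2"
    using equilateral_cos_bounds[OF assms] by (simp_all add: c_def equilateral_cos_def field_simps)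
  define s where "s = sqrt (1 - c\<^sup>2)"
  have s: "0 \<le> s" "s\<^sup>2 = 1 - c\<^sup>2" using c by (simp_all add: s_def)
  have s3: "3 / 2 \<le> sqrt 3" by (rule real_le_rsqrt) (simp add: power2_eq_square)
  have "(sqrt 3 / 2 - s) * (sqrt 3 / 2 + s) = 3 / 4 - s\<^sup>2"
    by (simp add: algebra_simps power2_eq_square)
  also have "\<dots> = (c - 1 / 2) * (c + 1 / 2)" unfolding s by (simp add: algebra_simps power2_eq_square)
  finally have eq: "(sqrt 3 / 2 - s) * (sqrt 3 / 2 + s) = (c - 1 / 2) * (c + 1 / 2)" .
  have "\<bar>sqrt 3 / 2 - s\<bar> * (3 / 4) \<le> \<bar>sqrt 3 / 2 - s\<bar> * (sqrt 3 / 2 + s)"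
    using s3 s by (intro mult_left_mono) auto
  also have "\<dots> = \<bar>(sqrt 3 / 2 - s) * (sqrt 3 / 2 + s)\<bar>"
    using s s3 by (simp add: abs_mult)
  also have "\<dots> = (c - 1 / 2) * (c + 1 / 2)" unfolding eq using c by simp
  also have "\<dots> \<le> (c - 1 / 2) * (3 / 2)" using c by (intro mult_left_mono) auto
  finally have "\<bar>s - sqrt 3 / 2\<bar> \<le> t\<^sup>2" unfolding c(4) by simp
  moreover have "norm (equilateral_rot t - \<zeta>) \<le> \<bar>c - 1 / 2\<bar> + \<bar>s - sqrt 3 / 2\<bar>"
    using cmod_le[of "equilateral_rot t - \<zeta>"] by (simp add: equilateral_rot_def \<zeta>_def c_def s_def)
  ultimately show ?thesis unfolding c(4) by simp
qed

text \<open>To first order, the third vertex is the one of the Euclidean equilateral triangle.\<close>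

lemma third_vertex_approx:
  assumes "norm p \<le> \<rho>" "norm q \<le> \<rho>" "\<rho> \<le> 1 / 10"
  shows "norm (third_vertex p q - (p + \<zeta> * (q - p))) \<le> 1000 * \<rho> ^ 3"
proof -
  have \<rho>: "0 \<le> \<rho>" using assms(1) norm_ge_zero order_trans by blast
  define u where "u = hyp_swap p q"
  define k where "k = equilateral_rot (norm u)"
  have r3: "24 * \<rho> ^ 3 \<le> \<rho>"
  proof -
    have "\<rho> * \<rho>\<^sup>2 \<le> \<rho> * (1 / 10)\<^sup>2" using assms \<rho> by (intro mult_left_mono power_mono) auto
    then show ?thesis using \<rho> by (simp add: power3_eq_cube power2_eq_square)
  qed
  have ua: "norm (u - (p - q)) \<le> 24 * \<rho> ^ 3"
    unfolding u_def using assms by (intro hyp_swap_approx) auto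
  have u3: "norm u \<le> 3 * \<rho>"
    using ua r3 norm_triangle_sub[of u "p - q"] norm_triangle_ineq4[of p q] assms by linarith
  then have u1: "norm u < 1" using assms by linarith
  have k: "norm k = 1" "norm (k - \<zeta>) \<le> 2 * (3 * \<rho>)\<^sup>2"
    using norm_equilateral_rot u1 equilateral_rot_approx[of "norm u"] power_mono[OF u3 norm_ge_zero, of 2]
    by (simp_all add: k_def)
  have z: "norm \<zeta> = 1" by (simp add: \<zeta>_def cmod_def power_divide)
  have "norm (third_vertex p q - (p - k * u)) \<le> 24 * (3 * \<rho>) ^ 3"
    unfolding third_vertex_def u_def[symmetric] k_def[symmetric]
    using assms \<rho> u3 k by (intro hyp_swap_approx) (auto simp: norm_mult)
  moreover have "norm (k * u - \<zeta> * (p - q)) \<le> 78 * \<rho> ^ 3"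
  proof -
    have "k * u - \<zeta> * (p - q) = (k - \<zeta>) * u + \<zeta> * (u - (p - q))" by (simp add: algebra_simps)
    then have "norm (k * u - \<zeta> * (p - q)) \<le> norm (k - \<zeta>) * norm u + norm (u - (p - q))"
      using norm_triangle_ineq[of "(k - \<zeta>) * u" "\<zeta> * (u - (p - q))"] by (simp add: norm_mult z)
    also have "\<dots> \<le> 2 * (3 * \<rho>)\<^sup>2 * (3 * \<rho>) + 24 * \<rho> ^ 3"
      using k u3 ua \<rho> by (intro add_mono mult_mono) auto
    finally show ?thesis by (simp add: power2_eq_square power3_eq_cube)
  qed
  moreover have "third_vertex p q - (p + \<zeta> * (q - p)) = (third_vertex p q - (p - k * u)) - (k * u - \<zeta> * (p - q))"
    by (simp add: algebra_simps)
  ultimately have "norm (third_vertex p q - (p + \<zeta> * (q - p))) \<le> 24 * (3 * \<rho>) ^ 3 + 78 * \<rho> ^ 3"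
    by (simp only: order_trans[OF norm_triangle_ineq4 add_mono])
  also have "\<dots> \<le> 1000 * \<rho> ^ 3" using \<rho> by (simp add: power3_eq_cube)
  finally show ?thesis .
qed

section \<open>Filling a planar disc by completing triangles\<close>

lemma zeta_simps: "norm \<zeta> = 1" "\<zeta>\<^sup>2 = \<zeta> - 1" "\<zeta> ^ 3 = -1"
proof -
  show "norm \<zeta> = 1" by (simp add: \<zeta>_def cmod_def power_divide)
  show 2: "\<zeta>\<^sup>2 = \<zeta> - 1" by (simp add: \<zeta>_def power2_eq_square complex_eq_iff)
  have "\<zeta> ^ 3 = \<zeta> * \<zeta>\<^sup>2" by (simp add: power3_eq_cube power2_eq_square)
  also have "\<dots> = \<zeta>\<^sup>2 - \<zeta>" by (subst 2) (simp add: algebra_simps power2_eq_square)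
  also have "\<dots> = -1" unfolding 2 by simp
  finally show "\<zeta> ^ 3 = -1" .
qed

text \<open>\<open>\<Psi>\<close> stands for \<open>norm (F p)\<close>, with \<open>F\<close> restricted to a plane through \<open>0\<close>. All points that occur
  below have norm at most \<open>40 * r\<close>; the bound on \<open>r\<close> makes the error \<open>1000 * (40 * r) ^ 3\<close> of
  \<open>third_vertex_approx\<close> at most \<open>r / 100\<close>.\<close>

locale equilateral_growth =
  fixes \<Psi> :: "complex \<Rightarrow> real" and K r :: real
  assumes K: "1 \<le> K" and r: "0 < r" "r \<le> 1 / 100000"
    and growth: "\<And>p q. norm p \<le> 40 * r \<Longrightarrow> norm q \<le> 40 * r \<Longrightarrow> norm (third_vertex p q) \<le> 40 * r \<Longrightarrow>
          \<Psi> (third_vertex p q) \<le> K * max (\<Psi> p) (\<Psi> q)"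
begin

lemma third_vertex_near:
  assumes "norm p \<le> 40 * r" "norm q \<le> 40 * r"
  shows "norm (third_vertex p q - (p + \<zeta> * (q - p))) \<le> r / 100"
proof -
  have "r * r\<^sup>2 \<le> r * (1 / 100000)\<^sup>2" using r by (intro mult_left_mono power_mono) auto
  then have "1000 * (40 * r) ^ 3 \<le> r / 100"
    using r(1) by (simp add: power2_eq_square power3_eq_cube)
  then show ?thesis using third_vertex_approx[OF assms] r by simp
qed

lemma growth_le:
  assumes "norm p \<le> 40 * r" "norm q \<le> 40 * r" "norm (third_vertex p q) \<le> 40 * r" "\<Psi> p \<le> M" "\<Psi> q \<le> M"
  shows "\<Psi> (third_vertex p q) \<le> K * M"
proof -
  have "K * max (\<Psi> p) (\<Psi> q) \<le> K * M" using assms K by (intro mult_left_mono) auto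
  then show ?thesis using growth[OF assms(1-3)] by linarith
qed

text \<open>Three rotations by about sixty degrees, hence nearly the point reflection about \<open>e\<close>.\<close>

definition reflect :: "complex \<Rightarrow> complex \<Rightarrow> complex" where
  "reflect e p = third_vertex e (third_vertex e (third_vertex e p))"

lemma third_vertex_step:
  assumes "norm e \<le> 40 * r" "norm p \<le> 40 * r" "norm (p - (e + z)) \<le> \<delta>"
  shows "norm (third_vertex e p - (e + \<zeta> * z)) \<le> \<delta> + r / 100"
proof -
  have "third_vertex e p - (e + \<zeta> * z) = (third_vertex e p - (e + \<zeta> * (p - e))) + \<zeta> * (p - (e + z))"
    by (simp add: algebra_simps)
  then have "norm (third_vertex e p - (e + \<zeta> * z)) = norm ((third_vertex e p - (e + \<zeta> * (p - e))) + \<zeta> * (p - (e + z)))"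
    by (rule arg_cong)
  then have "norm (third_vertex e p - (e + \<zeta> * z)) \<le> norm (third_vertex e p - (e + \<zeta> * (p - e))) + norm (p - (e + z))"
    using norm_triangle_ineq[of "third_vertex e p - (e + \<zeta> * (p - e))" "\<zeta> * (p - (e + z))"]
    by (simp add: norm_mult zeta_simps)
  then show ?thesis using third_vertex_near[OF assms(1,2)] assms(3) by linarith
qed

lemma reflect:
  assumes "norm e + norm (p - e) \<le> 39 * r"
  shows "norm (reflect e p - (2 * e - p)) \<le> 3 * r / 100"
    and "norm (third_vertex e p) \<le> 40 * r" "norm (third_vertex e (third_vertex e p)) \<le> 40 * r"
    and "norm (reflect e p) \<le> 40 * r"
    and "norm p \<le> 40 * r"
    and "\<Psi> e \<le> M \<Longrightarrow> \<Psi> p \<le> M \<Longrightarrow> 0 \<le> M \<Longrightarrow> \<Psi> (reflect e p) \<le> K ^ 3 * M"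
proof -
  have e: "norm e \<le> 40 * r" using assms norm_ge_zero[of "p - e"] r by linarith
  show p: "norm p \<le> 40 * r" using assms norm_triangle_sub[of p e] r by linarith
  have w: "norm w \<le> 40 * r" if "norm (w - (e + z)) \<le> \<delta>" "norm z = norm (p - e)" "\<delta> \<le> r" for w z \<delta>
    using that assms norm_triangle_sub[of w "e + z"] norm_triangle_ineq[of e z] by linarith
  define w1 where "w1 = third_vertex e p"
  define w2 where "w2 = third_vertex e w1"
  define w3 where "w3 = third_vertex e w2"
  have 1: "norm (w1 - (e + \<zeta> * (p - e))) \<le> 0 + r / 100"
    unfolding w1_def using e p by (intro third_vertex_step) auto
  have n1: "norm w1 \<le> 40 * r" by (rule w[OF 1]) (use r in \<open>auto simp: norm_mult zeta_simps\<close>)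
  have 2: "norm (w2 - (e + \<zeta> * (\<zeta> * (p - e)))) \<le> 0 + r / 100 + r / 100"
    unfolding w2_def by (rule third_vertex_step[OF e n1 1])
  have n2: "norm w2 \<le> 40 * r" by (rule w[OF 2]) (use r in \<open>auto simp: norm_mult zeta_simps\<close>)
  have 3: "norm (w3 - (e + \<zeta> * (\<zeta> * (\<zeta> * (p - e))))) \<le> 0 + r / 100 + r / 100 + r / 100"
    unfolding w3_def by (rule third_vertex_step[OF e n2 2])
  have n3: "norm w3 \<le> 40 * r" by (rule w[OF 3]) (use r in \<open>auto simp: norm_mult zeta_simps\<close>)
  have "\<zeta> * (\<zeta> * (\<zeta> * (p - e))) = \<zeta> ^ 3 * (p - e)" by (simp add: power3_eq_cube)
  then have "e + \<zeta> * (\<zeta> * (\<zeta> * (p - e))) = 2 * e - p" by (simp add: zeta_simps)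
  then show "norm (reflect e p - (2 * e - p)) \<le> 3 * r / 100"
    using 3 unfolding reflect_def w1_def w2_def w3_def by simp
  show "norm (third_vertex e p) \<le> 40 * r" "norm (third_vertex e (third_vertex e p)) \<le> 40 * r"
    "norm (reflect e p) \<le> 40 * r"
    using n1 n2 n3 by (simp_all add: w1_def w2_def w3_def reflect_def)
  show "\<Psi> (reflect e p) \<le> K ^ 3 * M" if M: "\<Psi> e \<le> M" "\<Psi> p \<le> M" "0 \<le> M"
  proof -
    have up: "x \<le> K * y" if "x \<le> y" "0 \<le> y" for x y
      using that mult_right_mono[OF K that(2)] by simp
    have M1: "\<Psi> w1 \<le> K * M" unfolding w1_def using e p n1 M by (intro growth_le) (auto simp: w1_def)
    have "\<Psi> w2 \<le> K * (K * M)" unfolding w2_def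
      using e n1 n2 M1 up[OF M(1) M(3)] by (intro growth_le) (auto simp: w2_def)
    moreover have "\<Psi> e \<le> K * (K * M)" using up[OF up[OF M(1) M(3)]] M K by simp
    ultimately have "\<Psi> w3 \<le> K * (K * (K * M))" unfolding w3_def
      using e n2 n3 by (intro growth_le) (auto simp: w3_def)
    then show ?thesis by (simp add: reflect_def w1_def w2_def w3_def power3_eq_cube mult.assoc)
  qed
qed

lemma continuous_on_reflect:
  fixes g :: "real \<Rightarrow> complex"
  assumes "continuous_on S g" "\<And>t. t \<in> S \<Longrightarrow> norm e + norm (g t - e) \<le> 39 * r"
  shows "continuous_on S (\<lambda>t. reflect e (g t))"
proof -
  have lt: "norm w < 1" if "norm w \<le> 40 * r" for w :: complex using that r by linarith
  have e: "norm e < 1" if "t \<in> S" for t using assms(2)[OF that] norm_ge_zero[of "g t - e"] r by linarith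
  have 1: "continuous_on S (\<lambda>t. third_vertex e (g t))"
    by (rule continuous_on_third_vertex[OF continuous_on_const assms(1) e lt[OF reflect(5)[OF assms(2)]]])
  have 2: "continuous_on S (\<lambda>t. third_vertex e (third_vertex e (g t)))"
    by (rule continuous_on_third_vertex[OF continuous_on_const 1 e lt[OF reflect(2)[OF assms(2)]]])
  show ?thesis
    unfolding reflect_def
    by (rule continuous_on_third_vertex[OF continuous_on_const 2 e lt[OF reflect(3)[OF assms(2)]]])
qed

text \<open>A path from \<open>0\<close> along which \<open>\<Psi>\<close> is at most \<open>M\<close> and which follows the segment from \<open>0\<close> to
  \<open>n * z\<close> with error \<open>D * r\<close>. The error \<open>d * r\<close> at the endpoint is recorded separately because the
  next doubling multiplies it by two; the error along the path must not be doubled, or it would grow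
  as fast as the length.\<close>

definition long_path :: "complex \<Rightarrow> real \<Rightarrow> real \<Rightarrow> real \<Rightarrow> real \<Rightarrow> bool" where
  "long_path z n d D M \<longleftrightarrow> (\<exists>g. continuous_on {0..1} g \<and> g 0 = 0 \<and> norm (g 1 - of_real n * z) \<le> d * r \<and>
      (\<forall>t\<in>{0..1}. norm (g t - of_real (t * n) * z) \<le> D * r \<and> \<Psi> (g t) \<le> M))"

text \<open>The path is continued by its own reflection about its endpoint.\<close>

lemma long_path_double:
  assumes g: "long_path z n d D M" and z: "norm z = r" and n: "0 \<le> n" "n + D \<le> 11" and D: "0 \<le> D" "0 \<le> d" and M: "0 \<le> M"
  shows "long_path z (2 * n) (2 * d + 3 / 100) (D + 2 * d + 3 / 100) (K ^ 3 * M)"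
proof -
  obtain g where g: "continuous_on {0..1} g" "g 0 = 0" "norm (g 1 - of_real n * z) \<le> d * r"
    and gt: "\<And>t. t \<in> {0..1} \<Longrightarrow> norm (g t - of_real (t * n) * z) \<le> D * r" "\<And>t. t \<in> {0..1} \<Longrightarrow> \<Psi> (g t) \<le> M"
    using g unfolding long_path_def by blast
  define e where "e = g 1"
  have ng: "norm (g t) \<le> 11 * r" if t: "t \<in> {0..1}" for t
  proof -
    have "norm (g t) \<le> norm (of_real (t * n) * z) + norm (g t - of_real (t * n) * z)" by (rule norm_triangle_sub)
    also have "\<dots> \<le> t * n * r + D * r" using gt(1)[OF t] t n z by (simp add: norm_mult abs_mult)
    also have "t * n * r \<le> n * r" using t n r by (intro mult_right_mono mult_left_le_one_le) auto
    also have "n * r + D * r \<le> 11 * r" using n(2) r by (metis distrib_right less_imp_le mult_right_mono)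
    finally show ?thesis by simp
  qed
  have sm: "norm e + norm (g t - e) \<le> 39 * r" if t: "t \<in> {0..1}" for t
    using ng[OF t] ng[of 1] norm_triangle_ineq4[of "g t" e] r unfolding e_def by simp
  have n2: "norm (2 * (e - of_real n * z)) \<le> 2 * (d * r)"
    using g(3) unfolding e_def norm_mult by simp
  define h where "h t = (if t \<le> 1 / 2 then g (2 * t) else reflect e (g (2 - 2 * t)))" for t
  have half: "h (1 / 2) = e" by (simp add: h_def e_def)
  have ee: "reflect e e = e"
    by (simp add: reflect_def third_vertex_def)
  have c1: "continuous_on {0..1 / 2} h"
  proof -
    have "continuous_on {0..1 / 2} (\<lambda>t. g (2 * t))"
      by (rule continuous_on_compose2[OF g(1)]) (auto intro!: continuous_intros)
    then show ?thesis by (rule continuous_on_eq) (auto simp: h_def)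
  qed
  have c2: "continuous_on {1 / 2..1} h"
  proof -
    have "continuous_on {1 / 2..1} (\<lambda>t. g (2 - 2 * t))"
      by (rule continuous_on_compose2[OF g(1)]) (auto intro!: continuous_intros)
    then have "continuous_on {1 / 2..1} (\<lambda>t. reflect e (g (2 - 2 * t)))"
      by (rule continuous_on_reflect) (auto intro!: sm)
    moreover have "reflect e (g (2 - 2 * t)) = h t" if "t \<in> {1 / 2..1}" for t
    proof (cases "t = 1 / 2")
      case True
      then have "2 - 2 * t = 1" by simp
      moreover have "h t = e" unfolding True by (rule half)
      ultimately show ?thesis by (simp only: ee e_def[symmetric])
    qed (use that in \<open>auto simp: h_def\<close>)
    ultimately show ?thesis by (rule continuous_on_eq)
  qed
  have "{0..1} = {0..1 / 2} \<union> {1 / 2..1::real}" by auto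
  then have cont: "continuous_on {0..1} h"
    using continuous_on_closed_Un[OF _ _ c1 c2] by simp
  have K3: "1 \<le> K ^ 3" using K by simp
  have bd: "norm (h t - of_real (t * (2 * n)) * z) \<le> (D + 2 * d + 3 / 100) * r \<and> \<Psi> (h t) \<le> K ^ 3 * M"
    if t: "t \<in> {0..1}" for t
  proof (cases "t \<le> 1 / 2")
    case True
    then have t': "2 * t \<in> {0..1}" using t by auto
    have "D * r \<le> (D + 2 * d + 3 / 100) * r" using D r by (intro mult_right_mono) auto
    moreover have "M \<le> K ^ 3 * M" using mult_right_mono[OF K3 M] by simp
    ultimately show ?thesis
      using gt[OF t'] True by (simp add: h_def mult.left_commute mult.commute)
  next
    case False
    then have t': "2 - 2 * t \<in> {0..1}" using t by auto
    define p where "p = g (2 - 2 * t)"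
    have h: "h t = reflect e p" using False by (simp add: h_def p_def)
    have "reflect e p - of_real (t * (2 * n)) * z = (reflect e p - (2 * e - p)) + 2 * (e - of_real n * z)
        - (p - of_real ((2 - 2 * t) * n) * z)"
      by (simp add: algebra_simps)
    then have "norm (h t - of_real (t * (2 * n)) * z) \<le> norm (reflect e p - (2 * e - p)) + norm (2 * (e - of_real n * z))
        + norm (p - of_real ((2 - 2 * t) * n) * z)"
      unfolding h by (simp only: order_trans[OF norm_triangle_ineq4 add_right_mono[OF norm_triangle_ineq]])
    also have "\<dots> \<le> 3 * r / 100 + 2 * (d * r) + D * r"
      unfolding p_def by (intro add_mono reflect(1)[OF sm[OF t']] n2 gt(1)[OF t'])
    also have "\<dots> = (D + 2 * d + 3 / 100) * r" by (simp add: algebra_simps)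
    finally show ?thesis
      using reflect(6)[OF sm[OF t'], of M] gt(2)[OF t'] gt(2)[of 1] M unfolding h p_def e_def by simp
  qed
  have end1: "norm (h 1 - of_real (2 * n) * z) \<le> (2 * d + 3 / 100) * r"
  proof -
    have h: "h 1 = reflect e 0" by (simp add: h_def g)
    have "reflect e 0 - of_real (2 * n) * z = (reflect e 0 - (2 * e - 0)) + 2 * (e - of_real n * z)"
      by (simp add: algebra_simps)
    then have "norm (h 1 - of_real (2 * n) * z) \<le> norm (reflect e 0 - (2 * e - 0)) + norm (2 * (e - of_real n * z))"
      unfolding h by (metis norm_triangle_ineq)
    also have "\<dots> \<le> 3 * r / 100 + 2 * (d * r)"
      using reflect(1)[OF sm[of 0]] g(2) by (intro add_mono n2) simp
    finally show ?thesis by (simp add: algebra_simps)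
  qed
  have "h 0 = 0" by (simp add: h_def g)
  with cont bd end1 show ?thesis
    unfolding long_path_def by (intro exI[of _ h]) simp
qed

text \<open>The inverse of the linear isomorphism \<open>(s, t) \<mapsto> (1 - \<zeta>) * s + \<zeta> * t\<close> from \<open>\<real>\<^sup>2\<close> onto the
  complex plane, with a bound for its norm.\<close>

lemma zeta_coordinates:
  fixes \<omega> :: complex
  defines "s \<equiv> Re \<omega> - Im \<omega> / sqrt 3" and "t \<equiv> Re \<omega> + Im \<omega> / sqrt 3"
  shows "(1 - \<zeta>) * of_real s + \<zeta> * of_real t = \<omega>" "s\<^sup>2 + t\<^sup>2 \<le> 2 * (norm \<omega>)\<^sup>2"
proof -
  show "(1 - \<zeta>) * of_real s + \<zeta> * of_real t = \<omega>"
    by (simp add: s_def t_def \<zeta>_def complex_eq_iff field_simps)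
  have "s\<^sup>2 + t\<^sup>2 = 2 * (Re \<omega>)\<^sup>2 + 2 / 3 * (Im \<omega>)\<^sup>2"
    by (simp add: s_def t_def power2_eq_square algebra_simps)
  then show "s\<^sup>2 + t\<^sup>2 \<le> 2 * (norm \<omega>)\<^sup>2" by (simp add: cmod_power2)
qed

text \<open>Four doublings and a reflection about \<open>0\<close> turn \<open>\<gamma>\<close> into a path \<open>h\<close> on \<open>[-1, 1]\<close> with
  \<open>h s \<approx> 16 * s * z\<close>. The third vertex over \<open>h s\<close> and \<open>h t\<close> then differs from the linear
  isomorphism \<open>16 * z * ((1 - \<zeta>) * s + \<zeta> * t)\<close> by less than \<open>6 * r\<close>, while the image of the unit
  disc under the latter contains the disc of radius \<open>16 * r / sqrt 2\<close>, which exceeds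
  \<open>6 * r + 2 * r\<close>. By Brouwer's fixed point theorem every \<open>y\<close> with \<open>norm y \<le> 2 * r\<close> is such a
  third vertex. The exponent 16 counts three completions for each of the five reflections and a
  last one.\<close>

theorem fill_disc:
  fixes \<gamma> :: "real \<Rightarrow> complex"
  assumes \<gamma>: "continuous_on {0..1} \<gamma>" "\<gamma> 0 = 0" "norm (\<gamma> 1) = r"
    and le: "\<And>t. t \<in> {0..1} \<Longrightarrow> norm (\<gamma> t) \<le> r" and M: "\<And>t. t \<in> {0..1} \<Longrightarrow> \<Psi> (\<gamma> t) \<le> M" "0 \<le> M"
    and y: "norm y \<le> 2 * r"
  shows "\<Psi> y \<le> K ^ 16 * M"
proof -
  define z where "z = \<gamma> 1"
  have z: "norm z = r" "z \<noteq> 0" using \<gamma> r by (auto simp: z_def)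
  have K0: "0 \<le> K" using K by simp
  have "norm (\<gamma> t - of_real t * z) \<le> 2 * r" if t: "t \<in> {0..1}" for t
  proof -
    have "norm (of_real t * z) \<le> 1 * r" using t z r by (simp add: norm_mult mult_left_le_one_le)
    then show ?thesis using norm_triangle_ineq4[of "\<gamma> t" "of_real t * z"] le[OF t] by linarith
  qed
  then have "long_path z 1 0 2 M"
    unfolding long_path_def using \<gamma> M by (intro exI[of _ \<gamma>]) (simp add: z_def)
  then have "long_path z (2 * 1) (2 * 0 + 3 / 100) (2 + 2 * 0 + 3 / 100) (K ^ 3 * M)"
    by (rule long_path_double) (use z M K0 in simp_all)
  then have "long_path z 2 (3 / 100) (203 / 100) (K ^ 3 * M)" by simp
  then have "long_path z (2 * 2) (2 * (3 / 100) + 3 / 100) (203 / 100 + 2 * (3 / 100) + 3 / 100) (K ^ 3 * (K ^ 3 * M))"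
    by (rule long_path_double) (use z M K0 in simp_all)
  then have "long_path z 4 (9 / 100) (212 / 100) (K ^ 6 * M)" by (simp flip: mult.assoc power_add)
  then have "long_path z (2 * 4) (2 * (9 / 100) + 3 / 100) (212 / 100 + 2 * (9 / 100) + 3 / 100) (K ^ 3 * (K ^ 6 * M))"
    by (rule long_path_double) (use z M K0 in simp_all)
  then have "long_path z 8 (21 / 100) (233 / 100) (K ^ 9 * M)" by (simp flip: mult.assoc power_add)
  then have "long_path z (2 * 8) (2 * (21 / 100) + 3 / 100) (233 / 100 + 2 * (21 / 100) + 3 / 100) (K ^ 3 * (K ^ 9 * M))"
    by (rule long_path_double) (use z M K0 in simp_all)
  then have "long_path z 16 (45 / 100) (278 / 100) (K ^ 12 * M)" by (simp flip: mult.assoc power_add)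
  then obtain g where g: "continuous_on {0..1} g" "g 0 = 0"
    and gt: "\<And>t. t \<in> {0..1} \<Longrightarrow> norm (g t - of_real (t * 16) * z) \<le> 278 / 100 * r"
      "\<And>t. t \<in> {0..1} \<Longrightarrow> \<Psi> (g t) \<le> K ^ 12 * M"
    unfolding long_path_def by blast
  have ng: "norm (g t) \<le> 19 * r" if t: "t \<in> {0..1}" for t
  proof -
    have "norm (of_real (t * 16) * z) \<le> 16 * r" using t z r by (simp add: norm_mult)
    then show ?thesis using norm_triangle_sub[of "g t" "of_real (t * 16) * z"] gt(1)[OF t] r by linarith
  qed
  define h where "h s = (if 0 \<le> s then g s else reflect 0 (g (- s)))" for s
  have sm: "norm (0::complex) + norm (g t - 0) \<le> 39 * r" if "t \<in> {0..1}" for t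
    using ng[OF that] r by simp
  have c1: "continuous_on {0..1} h"
    using g(1) by (rule continuous_on_eq) (auto simp: h_def)
  have c2: "continuous_on {-1..0} h"
  proof -
    have "continuous_on {-1..0} (\<lambda>t. g (- t))"
      by (rule continuous_on_compose2[OF g(1)]) (auto intro!: continuous_intros)
    then have "continuous_on {-1..0} (\<lambda>t. reflect 0 (g (- t)))"
      by (rule continuous_on_reflect) (auto intro!: sm[simplified])
    then show ?thesis by (rule continuous_on_eq) (auto simp: h_def g reflect_def third_vertex_def)
  qed
  have "{-1..1} = {-1..0} \<union> {0..1::real}" by auto
  then have hc: "continuous_on {-1..1} h"
    using continuous_on_closed_Un[OF _ _ c2 c1] by simp
  have K3: "1 \<le> K ^ 3" using K by simp
  have K12: "0 \<le> K ^ 12 * M" using K0 M by simp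
  have ht: "norm (h s - of_real (s * 16) * z) \<le> 281 / 100 * r \<and> \<Psi> (h s) \<le> K ^ 15 * M" if s: "s \<in> {-1..1}" for s
  proof (cases "0 \<le> s")
    case True
    have "K ^ 12 * M \<le> K ^ 3 * (K ^ 12 * M)" using mult_right_mono[OF K3 K12] by simp
    also have "\<dots> = K ^ 15 * M" by (simp flip: mult.assoc power_add)
    finally show ?thesis using gt[of s] s True r by (simp add: h_def)
  next
    case False
    then have s': "- s \<in> {0..1}" using s by auto
    define p where "p = g (- s)"
    have h: "h s = reflect 0 p" using False by (simp add: h_def p_def)
    have "reflect 0 p - of_real (s * 16) * z = (reflect 0 p - (2 * 0 - p)) - (p - of_real (- s * 16) * z)"
      by (simp add: algebra_simps)
    then have "norm (h s - of_real (s * 16) * z) \<le> norm (reflect 0 p - (2 * 0 - p)) + norm (p - of_real (- s * 16) * z)"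
      unfolding h by (metis norm_triangle_ineq4)
    also have "\<dots> \<le> 3 * r / 100 + 278 / 100 * r"
      unfolding p_def by (intro add_mono reflect(1)[OF sm[OF s']] gt(1)[OF s'])
    finally have 1: "norm (h s - of_real (s * 16) * z) \<le> 281 / 100 * r" by simp
    have "\<Psi> (h s) \<le> K ^ 3 * (K ^ 12 * M)"
      unfolding h p_def using gt(2)[OF s'] gt(2)[of 0] g(2) K12 by (intro reflect(6)[OF sm[OF s']]) auto
    also have "\<dots> = K ^ 15 * M" by (simp flip: mult.assoc power_add)
    finally show ?thesis using 1 by simp
  qed
  have nh: "norm (h s) \<le> 19 * r" if s: "s \<in> {-1..1}" for s
  proof -
    have "norm (of_real (s * 16) * z) \<le> 16 * r" using s z r by (simp add: norm_mult abs_le_iff)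
    then show ?thesis using norm_triangle_sub[of "h s" "of_real (s * 16) * z"] ht[OF s] r by linarith
  qed
  \<comment> \<open>The parameters \<open>(s, t)\<close> are the real and imaginary parts of \<open>\<xi>\<close>.\<close>
  define B where "B = cball (0::complex) 1"
  have Re: "Re \<xi> \<in> {-1..1}" and Im: "Im \<xi> \<in> {-1..1}" if "\<xi> \<in> B" for \<xi>
    using that abs_Re_le_cmod[of \<xi>] abs_Im_le_cmod[of \<xi>] unfolding B_def by (auto simp: abs_le_iff)
  define F where "F \<xi> = third_vertex (h (Re \<xi>)) (h (Im \<xi>))" for \<xi>
  define A where "A \<xi> = (1 - \<zeta>) * of_real (Re \<xi>) + \<zeta> * of_real (Im \<xi>)" for \<xi>
  have cRe: "continuous_on B (\<lambda>\<xi>. h (Re \<xi>))" and cIm: "continuous_on B (\<lambda>\<xi>. h (Im \<xi>))"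
    by (rule continuous_on_compose2[OF hc]; use Re Im in \<open>auto intro!: continuous_intros\<close>)+
  have Fc: "continuous_on B F"
    unfolding F_def
  proof (rule continuous_on_third_vertex[OF cRe cIm])
    show "norm (h (Re \<xi>)) < 1" "norm (h (Im \<xi>)) < 1" if "\<xi> \<in> B" for \<xi>
      using nh[OF Re[OF that]] nh[OF Im[OF that]] r by linarith+
  qed
  have FA: "norm (F \<xi> - 16 * z * A \<xi>) \<le> 566 / 100 * r" if \<xi>: "\<xi> \<in> B" for \<xi>
  proof -
    define a b where "a = h (Re \<xi>)" and "b = h (Im \<xi>)"
    have n: "norm a \<le> 40 * r" "norm b \<le> 40 * r"
      unfolding a_def b_def using nh[OF Re[OF \<xi>]] nh[OF Im[OF \<xi>]] r by linarith+
    have "norm (1 - \<zeta>) = 1" by (simp add: \<zeta>_def cmod_def power_divide)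
    moreover have "F \<xi> - 16 * z * A \<xi> = (third_vertex a b - (a + \<zeta> * (b - a)))
       + ((1 - \<zeta>) * (a - of_real (Re \<xi> * 16) * z) + \<zeta> * (b - of_real (Im \<xi> * 16) * z))"
      unfolding F_def A_def a_def b_def by (simp add: algebra_simps)
    ultimately have "norm (F \<xi> - 16 * z * A \<xi>) \<le> norm (third_vertex a b - (a + \<zeta> * (b - a)))
       + (norm (a - of_real (Re \<xi> * 16) * z) + norm (b - of_real (Im \<xi> * 16) * z))"
      using norm_triangle_ineq[of "third_vertex a b - (a + \<zeta> * (b - a))"
          "(1 - \<zeta>) * (a - of_real (Re \<xi> * 16) * z) + \<zeta> * (b - of_real (Im \<xi> * 16) * z)"]
        norm_triangle_ineq[of "(1 - \<zeta>) * (a - of_real (Re \<xi> * 16) * z)" "\<zeta> * (b - of_real (Im \<xi> * 16) * z)"]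
      by (simp only: norm_mult zeta_simps mult_1)
    then show ?thesis
      using third_vertex_near[OF n] ht[OF Re[OF \<xi>]] ht[OF Im[OF \<xi>]] r unfolding a_def b_def by linarith
  qed
  \<comment> \<open>A fixed point of \<open>Q\<close>, the inverse of \<open>A\<close> applied to \<open>\<omega>\<close>, is a solution of \<open>F \<xi> = y\<close>.\<close>
  define \<omega> where "\<omega> \<xi> = (y - F \<xi>) / (16 * z) + A \<xi>" for \<xi>
  define Q where "Q \<xi> = Complex (Re (\<omega> \<xi>) - Im (\<omega> \<xi>) / sqrt 3) (Re (\<omega> \<xi>) + Im (\<omega> \<xi>) / sqrt 3)" for \<xi>
  have \<omega>: "norm (\<omega> \<xi>) \<le> 1 / 2" if "\<xi> \<in> B" for \<xi>
  proof -
    have "\<omega> \<xi> = (y - (F \<xi> - 16 * z * A \<xi>)) / (16 * z)"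
      using z by (simp add: \<omega>_def field_simps)
    then have "norm (\<omega> \<xi>) = norm (y - (F \<xi> - 16 * z * A \<xi>)) / (16 * r)"
      using z by (simp add: norm_divide norm_mult)
    also have "norm (y - (F \<xi> - 16 * z * A \<xi>)) \<le> 8 * r"
      using norm_triangle_ineq4[of y "F \<xi> - 16 * z * A \<xi>"] FA[OF that] y r by linarith
    then have "norm (y - (F \<xi> - 16 * z * A \<xi>)) / (16 * r) \<le> 1 / 2"
      using r by (simp add: divide_le_eq)
    finally show ?thesis .
  qed
  have "Q \<in> B \<rightarrow> B"
  proof
    fix \<xi> assume "\<xi> \<in> B"
    have "(norm (Q \<xi>))\<^sup>2 \<le> 2 * (norm (\<omega> \<xi>))\<^sup>2"
      using zeta_coordinates(2)[of "\<omega> \<xi>"] by (simp add: Q_def cmod_power2)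
    also have "\<dots> \<le> 2 * (1 / 2)\<^sup>2" using \<omega>[OF \<open>\<xi> \<in> B\<close>] by (intro mult_left_mono power_mono) auto
    finally have "(norm (Q \<xi>))\<^sup>2 \<le> 1\<^sup>2" by (simp add: power2_eq_square)
    then show "Q \<xi> \<in> B" unfolding B_def using power2_le_imp_le[of "norm (Q \<xi>)" 1] by simp
  qed
  moreover have "continuous_on B Q"
  proof -
    have "continuous_on B \<omega>"
      unfolding \<omega>_def A_def using z by (intro continuous_intros Fc) auto
    then show ?thesis unfolding Q_def Complex_eq by (intro continuous_intros) auto
  qed
  moreover have "compact B" "convex B" "B \<noteq> {}" by (auto simp: B_def)
  ultimately obtain \<xi> where \<xi>: "\<xi> \<in> B" "Q \<xi> = \<xi>"
    using brouwer[of B Q] by blast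
  have "A \<xi> = \<omega> \<xi>"
    using zeta_coordinates(1)[of "\<omega> \<xi>"] \<xi>(2) unfolding A_def
    by (metis Q_def complex.sel)
  then have yF: "y = F \<xi>" using z by (simp add: \<omega>_def)
  have "\<Psi> y \<le> K * (K ^ 15 * M)"
    unfolding yF F_def
  proof (rule growth_le)
    show "norm (third_vertex (h (Re \<xi>)) (h (Im \<xi>))) \<le> 40 * r"
      using y yF r by (simp add: F_def)
  qed (use nh[OF Re[OF \<xi>(1)]] nh[OF Im[OF \<xi>(1)]] ht[OF Re[OF \<xi>(1)]] ht[OF Im[OF \<xi>(1)]] r in auto)
  then show ?thesis by (simp flip: mult.assoc power_Suc)
qed

end

section \<open>Weak quasisymmetry at the origin\<close>

lemma ex_unit_orthogonal:
  fixes S :: "'a::euclidean_space set"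
  assumes "finite S" "card S < DIM('a)"
  shows "\<exists>e::'a. norm e = 1 \<and> (\<forall>v\<in>S. v \<bullet> e = 0)"
proof -
  have "dim S < DIM('a)" using assms dim_le_card' le_less_trans by blast
  then obtain x where x: "x \<noteq> 0" "\<And>y. y \<in> span S \<Longrightarrow> orthogonal x y"
    using orthogonal_to_subspace_exists by blast
  have "v \<bullet> sgn x = 0" if "v \<in> S" for v
    using x(2)[OF span_base[OF that]] by (simp add: orthogonal_def sgn_div_norm inner_commute)
  then show ?thesis using x(1) by (intro exI[of _ "sgn x"]) (simp add: norm_sgn)
qed

locale growth_at_0 =
  fixes F G :: "'a::euclidean_space \<Rightarrow> 'a" and K R :: real
  assumes homeo: "homeomorphism (ball 0 1) (ball 0 1) F G" and F0: "F 0 = 0"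
    and K: "1 \<le> K" and R: "0 < R" "R \<le> 1"
    and growth: "\<And>p q w. norm p < R \<Longrightarrow> norm q < R \<Longrightarrow> norm w < R \<Longrightarrow> hyp_quot p q = hyp_quot q w \<Longrightarrow>
        hyp_quot p q = hyp_quot p w \<Longrightarrow> norm (F w) \<le> K * max (norm (F p)) (norm (F q))"
begin

lemma fill_plane_disc:
  fixes e1 e2 :: 'a and \<gamma> :: "real \<Rightarrow> complex"
  defines "\<iota> \<equiv> \<lambda>c. Re c *\<^sub>R e1 + Im c *\<^sub>R e2"
  assumes e: "norm e1 = 1" "norm e2 = 1" "e1 \<bullet> e2 = 0"
    and r: "0 < r" "r \<le> 1 / 100000" "40 * r < R"
    and \<gamma>: "continuous_on {0..1} \<gamma>" "\<gamma> 0 = 0" "norm (\<gamma> 1) = r"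
    and le: "\<And>t. t \<in> {0..1} \<Longrightarrow> norm (\<gamma> t) \<le> r" and M: "\<And>t. t \<in> {0..1} \<Longrightarrow> norm (F (\<iota> (\<gamma> t))) \<le> M" "0 \<le> M"
    and y: "norm y \<le> 2 * r"
  shows "norm (F (\<iota> y)) \<le> K ^ 16 * M"
proof -
  have ee: "e1 \<bullet> e1 = 1" "e2 \<bullet> e2 = 1" "e2 \<bullet> e1 = 0"
    using e by (simp_all add: norm_eq_1 inner_commute)
  have "\<iota> c \<bullet> \<iota> c = c \<bullet> c" for c
    by (simp add: \<iota>_def inner_simps ee e inner_complex_def)
  then have n: "norm (\<iota> c) = norm c" for c by (simp add: norm_eq_sqrt_inner)
  have "\<iota> c - \<iota> d = \<iota> (c - d)" for c d by (simp add: \<iota>_def algebra_simps)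
  then have q: "hyp_quot (\<iota> c) (\<iota> d) = hyp_quot c d" for c d
    by (simp add: hyp_quot_def n)
  interpret equilateral_growth "\<lambda>c. norm (F (\<iota> c))" K r
  proof
    fix p q assume 1: "norm p \<le> 40 * r" "norm q \<le> 40 * r" "norm (third_vertex p q) \<le> 40 * r"
    then have "norm p < 1" "norm q < 1" using r R by linarith+
    then show "norm (F (\<iota> (third_vertex p q))) \<le> K * max (norm (F (\<iota> p))) (norm (F (\<iota> q)))"
      using 1 r third_vertex[of p q] by (intro growth) (auto simp: n q)
  qed (use K r in auto)
  show ?thesis by (rule fill_disc) (use \<gamma> le M y in auto)
qed

text \<open>The maximum principle: the image of the open ball is open, so \<open>norm (F x)\<close> has no maximum in it.\<close>

lemma norm_F_le_of_sphere:
  assumes r: "0 < r" "r < 1" and M: "\<And>p. norm p = r \<Longrightarrow> norm (F p) \<le> M" and x: "norm x \<le> r"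
  shows "norm (F x) \<le> M"
proof -
  have cF: "continuous_on (ball 0 1) F" using homeo by (simp add: homeomorphism_def)
  have "continuous_on (cball 0 r) (\<lambda>x. norm (F x))"
    using r by (intro continuous_on_norm continuous_on_subset[OF cF]) auto
  then obtain x0 where x0: "x0 \<in> cball 0 r" "\<And>y. y \<in> cball 0 r \<Longrightarrow> norm (F y) \<le> norm (F x0)"
    using continuous_attains_sup[of "cball 0 r" "\<lambda>x. norm (F x)"] r by auto
  have "norm x0 = r"
  proof (rule ccontr)
    assume "norm x0 \<noteq> r"
    then have x0b: "x0 \<in> ball 0 r" using x0 by auto
    have "openin (top_of_set (ball 0 1)) (ball (0::'a) r)"
      using r by (intro open_subset) auto
    then have "openin (top_of_set (ball 0 1)) (F ` ball 0 r)"
      by (rule homeomorphism_imp_open_map[OF homeo])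
    then have "open (F ` ball 0 r)"
      by (simp add: openin_open_eq)
    moreover have "F ` ball 0 r \<subseteq> cball 0 (norm (F x0))" using x0 by auto
    ultimately have "F ` ball 0 r \<subseteq> ball 0 (norm (F x0))"
      using interior_maximal by (metis interior_cball)
    then have "F x0 \<in> ball 0 (norm (F x0))" using x0b by blast
    then show False by simp
  qed
  then show ?thesis using M[of x0] x0(2)[of x] x by auto
qed

text \<open>The inner product is the one for which \<open>0\<close>, \<open>p\<close>, \<open>q\<close> form an equilateral triangle; the vertex \<open>0\<close>
  is fixed by \<open>F\<close> and contributes nothing to the bound.\<close>

lemma rotation_step:
  assumes r: "norm p = r" "norm q = r" "0 < r" "r < R" and pq: "p \<bullet> q = (1 + r\<^sup>2) / 2 * r\<^sup>2"
  shows "norm (F q) \<le> K * norm (F p)"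
proof -
  have r1: "r < 1" using r R by simp
  have "(norm (p - q))\<^sup>2 = (norm p)\<^sup>2 + (norm q)\<^sup>2 - 2 * (p \<bullet> q)"
    unfolding power2_norm_eq_inner by (simp add: inner_simps inner_commute)
  also have "\<dots> = r\<^sup>2 * (1 - r\<^sup>2)" unfolding pq using r by (simp add: algebra_simps)
  finally have d: "(norm (p - q))\<^sup>2 = r\<^sup>2 * (1 - r\<^sup>2)" .
  have pos: "0 < 1 - r\<^sup>2" using one_minus_norm_sq_pos[of p] r r1 by simp
  have "hyp_quot p q = r\<^sup>2 / (1 - r\<^sup>2)"
    using pos unfolding hyp_quot_def d r(1,2) by simp
  moreover have "hyp_quot 0 p = r\<^sup>2 / (1 - r\<^sup>2)" "hyp_quot 0 q = r\<^sup>2 / (1 - r\<^sup>2)"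
    using r by (simp_all add: hyp_quot_def)
  ultimately have "norm (F q) \<le> K * max (norm (F 0)) (norm (F p))"
    using r R by (intro growth) auto
  then show ?thesis by (simp add: F0)
qed

text \<open>Over two points of the sphere at an angle of at most ninety degrees there is an isosceles
  spherical triangle whose two equal sides are the angle of an equilateral triangle, because that angle
  exceeds forty-five degrees. Its apex \<open>w\<close> lies above the midpoint of \<open>p\<close> and \<open>q\<close> in a direction
  orthogonal to both; this is where dimension three enters.\<close>

lemma rotation_acute:
  assumes dim: "3 \<le> DIM('a)" and r: "norm p = r" "norm q = r" "0 < r" "r < R" "r \<le> 1 / 2" and pq: "0 \<le> p \<bullet> q"
  shows "norm (F q) \<le> K\<^sup>2 * norm (F p)"
proof -
  have "card {p, q} < DIM('a)" using dim card_insert_le_m1[of 2 "{q}" p] by simp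
  then obtain e where e: "norm e = 1" "p \<bullet> e = 0" "q \<bullet> e = 0"
    using ex_unit_orthogonal[of "{p, q}"] by auto
  define s where "s = p \<bullet> q"
  define c where "c = (1 + r\<^sup>2) / 2"
  define \<alpha> where "\<alpha> = c * r\<^sup>2 / (r\<^sup>2 + s)"
  define b where "b = r\<^sup>2 - \<alpha>\<^sup>2 * (2 * (r\<^sup>2 + s))"
  define w where "w = \<alpha> *\<^sub>R (p + q) + sqrt b *\<^sub>R e"
  have r2: "0 < r\<^sup>2" "r\<^sup>2 \<le> 1 / 4" using r power_mono[of r "1/2" 2] by (auto simp: power2_eq_square)
  have s: "0 \<le> s" using pq by (simp add: s_def)
  have c: "0 \<le> c" "c \<le> 5 / 8" using r2 by (auto simp: c_def)
  then have c2: "2 * c\<^sup>2 \<le> 1" using power_mono[of c "5/8" 2] by (simp add: power2_eq_square)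
  have pp: "p \<bullet> p = r\<^sup>2" "q \<bullet> q = r\<^sup>2" "q \<bullet> p = s" "p \<bullet> q = s" "e \<bullet> e = 1" "e \<bullet> p = 0" "e \<bullet> q = 0"
    using r e by (simp_all add: s_def power2_norm_eq_inner[symmetric] inner_commute norm_eq_1)
  have rs: "0 < r\<^sup>2 + s" using r2 s by linarith
  then have \<alpha>: "\<alpha> * (r\<^sup>2 + s) = c * r\<^sup>2" by (simp add: \<alpha>_def)
  have "\<alpha>\<^sup>2 * (2 * (r\<^sup>2 + s)) = 2 * \<alpha> * (\<alpha> * (r\<^sup>2 + s))" by (simp add: power2_eq_square)
  also have "\<dots> = 2 * c * r\<^sup>2 * \<alpha>" unfolding \<alpha> by simp
  also have "\<alpha> \<le> c"
    using rs s c by (simp add: \<alpha>_def pos_divide_le_eq mult_left_mono)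
  then have "2 * c * r\<^sup>2 * \<alpha> \<le> 2 * c * r\<^sup>2 * c" using c r2 by (intro mult_left_mono) auto
  also have "\<dots> = 2 * c\<^sup>2 * r\<^sup>2" by (simp add: power2_eq_square)
  also have "\<dots> \<le> 1 * r\<^sup>2" using c2 r2 by (intro mult_right_mono) auto
  finally have b: "0 \<le> b" by (simp add: b_def)
  have wp: "w \<bullet> p = c * r\<^sup>2" and wq: "w \<bullet> q = c * r\<^sup>2"
    using \<alpha> by (simp_all add: w_def inner_simps pp e algebra_simps)
  have "w \<bullet> w = \<alpha>\<^sup>2 * (2 * (r\<^sup>2 + s)) + (sqrt b)\<^sup>2"
    by (simp add: w_def inner_simps pp e algebra_simps power2_eq_square)
  also have "\<dots> = r\<^sup>2" using b by (simp add: b_def)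
  finally have nw: "norm w = r" using r by (simp add: norm_eq_sqrt_inner)
  have 1: "norm (F w) \<le> K * norm (F p)"
    using r nw wp by (intro rotation_step) (auto simp: c_def inner_commute)
  have 2: "norm (F q) \<le> K * norm (F w)"
    using r nw wq by (intro rotation_step) (auto simp: c_def inner_commute)
  show ?thesis
    using order_trans[OF 2 mult_left_mono[OF 1]] K by (simp add: power2_eq_square mult.assoc)
qed

text \<open>A point orthogonal to both \<open>p\<close> and \<open>q\<close> is an intermediate stop at ninety degrees from each.\<close>

lemma rotation:
  assumes dim: "3 \<le> DIM('a)" and r: "norm p = r" "norm q = r" "0 < r" "r < R" "r \<le> 1 / 2"
  shows "norm (F q) \<le> K ^ 4 * norm (F p)"
proof -
  have "card {p, q} < DIM('a)" using dim card_insert_le_m1[of 2 "{q}" p] by simp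
  then obtain e where e: "norm e = 1" "p \<bullet> e = 0" "q \<bullet> e = 0"
    using ex_unit_orthogonal[of "{p, q}"] by auto
  have ne: "norm (r *\<^sub>R e) = r" using e r by simp
  have 1: "norm (F (r *\<^sub>R e)) \<le> K\<^sup>2 * norm (F p)"
    using dim r ne e by (intro rotation_acute[of _ r]) auto
  have 2: "norm (F q) \<le> K\<^sup>2 * norm (F (r *\<^sub>R e))"
    using dim r ne e by (intro rotation_acute[of _ r]) (auto simp: inner_commute)
  have "norm (F q) \<le> K\<^sup>2 * (K\<^sup>2 * norm (F p))"
    using order_trans[OF 2 mult_left_mono[OF 1]] by simp
  then show ?thesis by (simp flip: mult.assoc power_add)
qed

text \<open>The preimage of the segment from \<open>0\<close> to \<open>F z\<close>. If it left the ball of radius \<open>r\<close>, it would cross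
  the sphere before its end, at a point with an image shorter than \<open>F z\<close>.\<close>

lemma minimal_path:
  assumes r: "0 < r" "r < 1" and z: "norm z = r" and min: "\<And>p. norm p = r \<Longrightarrow> norm (F z) \<le> norm (F p)"
  shows "\<exists>\<gamma>::real \<Rightarrow> 'a. continuous_on {0..1} \<gamma> \<and> \<gamma> 0 = 0 \<and> \<gamma> 1 = z \<and>
    (\<forall>t\<in>{0..1}. norm (\<gamma> t) \<le> r \<and> norm (F (\<gamma> t)) \<le> norm (F z))"
proof -
  have GF: "G (F x) = x" "norm (F x) < 1" if "norm x < 1" for x
  proof -
    have x: "x \<in> ball 0 1" using that by simp
    then show "G (F x) = x" using homeo by (simp add: homeomorphism_def)
    have "F ` ball 0 1 = ball 0 1" using homeo by (simp add: homeomorphism_def)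
    then have "F x \<in> ball 0 1" using x by blast
    then show "norm (F x) < 1" by simp
  qed
  have FG: "F (G x) = x" if "norm x < 1" for x
    using homeo that by (simp add: homeomorphism_def)
  have cG: "continuous_on (ball 0 1) G" using homeo by (simp add: homeomorphism_def)
  have G0: "G 0 = 0" using GF(1)[of 0] F0 by simp
  have Fz: "norm (F z) < 1" using GF z r by simp
  have "F z \<noteq> 0" using GF(1)[of z] G0 z r by auto
  have seg: "norm (t *\<^sub>R F z) < 1" if "t \<in> {0..1}" for t
    using that mult_left_le_one_le[of "norm (F z)" t] Fz by simp
  define \<gamma> where "\<gamma> t = G (t *\<^sub>R F z)" for t
  have F\<gamma>: "F (\<gamma> t) = t *\<^sub>R F z" if "t \<in> {0..1}" for t
    unfolding \<gamma>_def by (rule FG[OF seg[OF that]])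
  have c: "continuous_on {0..1} \<gamma>"
    unfolding \<gamma>_def by (rule continuous_on_compose2[OF cG]) (use seg in \<open>auto intro!: continuous_intros\<close>)
  have g0: "\<gamma> 0 = 0" by (simp add: \<gamma>_def G0)
  have g1: "\<gamma> 1 = z" using GF z r by (simp add: \<gamma>_def)
  have 1: "norm (F (\<gamma> t)) \<le> norm (F z)" if "t \<in> {0..1}" for t
    using that mult_left_le_one_le[of "norm (F z)" t] by (simp add: F\<gamma>)
  have 2: "norm (\<gamma> t) \<le> r" if t: "t \<in> {0..1}" for t
  proof (rule ccontr)
    assume "\<not> norm (\<gamma> t) \<le> r"
    moreover have "continuous_on {0..t} (\<lambda>t. norm (\<gamma> t))"
      using t by (intro continuous_on_norm continuous_on_subset[OF c]) auto
    ultimately obtain s where s: "0 \<le> s" "s \<le> t" "norm (\<gamma> s) = r"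
      using IVT'[of "\<lambda>t. norm (\<gamma> t)" 0 r t] g0 r t by auto
    then have s1: "s \<in> {0..1}" using t by auto
    have "norm (F z) \<le> s * norm (F z)" using min[OF s(3)] F\<gamma>[OF s1] s by simp
    then have "1 \<le> s" using \<open>F z \<noteq> 0\<close> by (simp add: mult_le_cancel_right1)
    then have "t = 1" using s t by auto
    then show False using \<open>\<not> norm (\<gamma> t) \<le> r\<close> g1 z by simp
  qed
  show ?thesis using c g0 g1 1 2 by blast
qed

theorem weak_quasisymmetry_at_0:
  assumes dim: "2 \<le> DIM('a)" and z: "0 < norm z" "norm z \<le> 1 / 100000" "40 * norm z < R"
    and y: "norm y \<le> 2 * norm z"
  shows "norm (F y) \<le> K ^ 20 * norm (F z)"
proof -
  define r where "r = norm z"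
  have r: "0 < r" "r \<le> 1 / 100000" "40 * r < R" "r < 1" using z R by (auto simp: r_def)
  have cF: "continuous_on (ball 0 1) F" using homeo by (simp add: homeomorphism_def)
  have "continuous_on (sphere 0 r) (\<lambda>x. norm (F x))"
    using r by (intro continuous_on_norm continuous_on_subset[OF cF]) auto
  then obtain z0 where "z0 \<in> sphere 0 r" "\<And>p. p \<in> sphere 0 r \<Longrightarrow> norm (F z0) \<le> norm (F p)"
    using continuous_attains_inf[of "sphere 0 r" "\<lambda>x. norm (F x)"] r_def by auto
  then have z0: "norm z0 = r" and min: "\<And>p. norm p = r \<Longrightarrow> norm (F z0) \<le> norm (F p)" by auto
  have K0: "0 \<le> K" using K by simp
  have "norm (F y) \<le> K ^ 20 * norm (F z0)"
  proof (cases "DIM('a) = 2")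
    case True
    obtain e1 :: 'a where e1: "norm e1 = 1" using vector_choose_size[of 1] by auto
    obtain e2 :: 'a where e2: "norm e2 = 1" "e1 \<bullet> e2 = 0"
      using ex_unit_orthogonal[of "{e1}"] True by auto
    have ee: "e1 \<bullet> e1 = 1" "e2 \<bullet> e2 = 1" "e2 \<bullet> e1 = 0"
      using e1 e2 by (simp_all add: norm_eq_1 inner_commute)
    \<comment> \<open>In dimension two the plane of \<open>e1\<close> and \<open>e2\<close> is the whole space and contains the path.\<close>
    have dec: "v = (v \<bullet> e1) *\<^sub>R e1 + (v \<bullet> e2) *\<^sub>R e2" for v
    proof -
      define u where "u = v - ((v \<bullet> e1) *\<^sub>R e1 + (v \<bullet> e2) *\<^sub>R e2)"
      have u: "u \<bullet> e1 = 0" "u \<bullet> e2 = 0" by (simp_all add: u_def inner_simps ee e2)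
      have ne: "e1 \<noteq> e2" using ee e2 by auto
      have "u = 0"
      proof (rule ccontr)
        assume "u \<noteq> 0"
        have "pairwise orthogonal {u, e1, e2}"
          using u e2 ee by (auto simp: pairwise_def orthogonal_def inner_commute)
        moreover have "0 \<notin> {u, e1, e2}" using \<open>u \<noteq> 0\<close> e1 e2 by auto
        ultimately have "independent {u, e1, e2}" by (rule pairwise_orthogonal_independent)
        then have "card {u, e1, e2} \<le> 2" using independent_bound True by metis
        moreover have "u \<noteq> e1" "u \<noteq> e2" using u ee by auto
        ultimately show False using ne by simp
      qed
      then show ?thesis by (simp add: u_def)
    qed
    define \<iota> where "\<iota> c = Re c *\<^sub>R e1 + Im c *\<^sub>R e2" for c
    define \<kappa> where "\<kappa> v = Complex (v \<bullet> e1) (v \<bullet> e2)" for v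
    have \<iota>\<kappa>: "\<iota> (\<kappa> v) = v" for v using dec[of v] by (simp add: \<iota>_def \<kappa>_def)
    have "\<kappa> v \<bullet> \<kappa> v = v \<bullet> v" for v
      by (subst (2) dec[of v], subst (3) dec[of v]) (simp add: \<kappa>_def inner_complex_def inner_simps ee e2)
    then have n: "norm (\<kappa> v) = norm v" for v by (simp add: norm_eq_sqrt_inner)
    obtain \<gamma> :: "real \<Rightarrow> 'a" where \<gamma>: "continuous_on {0..1} \<gamma>" "\<gamma> 0 = 0" "\<gamma> 1 = z0"
      "\<And>t. t \<in> {0..1} \<Longrightarrow> norm (\<gamma> t) \<le> r" "\<And>t. t \<in> {0..1} \<Longrightarrow> norm (F (\<gamma> t)) \<le> norm (F z0)"
      using minimal_path[OF r(1,4) z0 min] by blast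
    have "norm (F (\<iota> (\<kappa> y))) \<le> K ^ 16 * norm (F z0)"
      unfolding \<iota>_def
    proof (rule fill_plane_disc[OF e1 e2 r(1-3), of "\<lambda>t. \<kappa> (\<gamma> t)"])
      show "continuous_on {0..1} (\<lambda>t. \<kappa> (\<gamma> t))"
        unfolding \<kappa>_def Complex_eq by (intro continuous_intros \<gamma>(1))
      show "\<kappa> (\<gamma> 0) = 0" by (simp add: \<gamma> \<kappa>_def complex_eq_iff)
    qed (use \<gamma> y in \<open>auto simp: n z0 r_def \<iota>\<kappa> \<iota>_def[symmetric]\<close>)
    also have "\<dots> \<le> K ^ 20 * norm (F z0)"
      using K by (intro mult_right_mono power_increasing) auto
    finally show ?thesis by (simp add: \<iota>\<kappa>)
  next
    case False
    then have dim3: "3 \<le> DIM('a)" using dim by simp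
    define M where "M = K ^ 4 * norm (F z0)"
    have M: "0 \<le> M" using K0 by (simp add: M_def)
    have sph: "norm (F p) \<le> M" if "norm p = r" for p
      unfolding M_def using r that z0 by (intro rotation[OF dim3, of _ r]) auto
    have ballM: "norm (F p) \<le> M" if "norm p \<le> r" for p
      using norm_F_le_of_sphere[OF r(1,4) sph that] .
    show ?thesis
    proof (cases "y = 0")
      case True
      then show ?thesis using F0 K0 by simp
    next
      case False
      define e1 where "e1 = sgn y"
      have e1: "norm e1 = 1" using False by (simp add: e1_def norm_sgn)
      obtain e2 :: 'a where e2: "norm e2 = 1" "e1 \<bullet> e2 = 0"
        using ex_unit_orthogonal[of "{e1}"] dim3 by auto
      \<comment> \<open>The plane is chosen through \<open>y\<close>, and the path is the radius in direction \<open>y\<close>.\<close>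
      have "norm (F (Re (of_real (norm y)) *\<^sub>R e1 + Im (of_real (norm y)) *\<^sub>R e2)) \<le> K ^ 16 * M"
      proof (rule fill_plane_disc[OF e1 e2 r(1-3), of "\<lambda>t. of_real (t * r)"])
        show "continuous_on {0..1} (\<lambda>t. complex_of_real (t * r))" by (intro continuous_intros)
        show "norm (complex_of_real (t * r)) \<le> r" if "t \<in> {0..1}" for t
          using that r by (simp add: norm_mult mult_left_le_one_le)
        show "norm (F (Re (complex_of_real (t * r)) *\<^sub>R e1 + Im (complex_of_real (t * r)) *\<^sub>R e2)) \<le> M"
          if "t \<in> {0..1}" for t
          using that r e1 by (intro ballM) (simp add: abs_mult mult_left_le_one_le)
      qed (use r M y in \<open>auto simp: r_def\<close>)
      also have "K ^ 16 * M = K ^ 20 * norm (F z0)" by (simp add: M_def flip: mult.assoc power_add)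
      finally show ?thesis using False by (simp add: e1_def sgn_div_norm)
    qed
  qed
  also have "\<dots> \<le> K ^ 20 * norm (F z)"
    using min[of z] K0 by (intro mult_left_mono) (auto simp: r_def)
  finally show ?thesis .
qed

end

section \<open>From the origin to an arbitrary point\<close>

lemma homeomorphism_hyp_swap:
  assumes "norm (a::'a::euclidean_space) < 1"
  shows "homeomorphism (ball 0 1) (ball 0 1) (hyp_swap a) (hyp_swap a)"
proof -
  have "hyp_swap a ` ball 0 1 = ball 0 1"
    using norm_hyp_swap_less_1[OF assms] hyp_swap_hyp_swap[OF assms] by (force simp: image_iff)
  then show ?thesis
    using continuous_on_hyp_swap[OF continuous_on_const continuous_on_id, of "ball 0 1" a] assms
      hyp_swap_hyp_swap[OF assms] by (simp add: homeomorphism_def)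
qed

text \<open>By \<open>norm_sq_hyp_swap_diff\<close>, \<open>norm (hyp_swap a y)\<close> is \<open>norm (y - a)\<close> divided by a continuous positive
  function of \<open>y\<close>. So \<open>hyp_swap a\<close> maps small spheres about \<open>a\<close> into shells about \<open>0\<close> whose radii
  have ratio at most 2.\<close>

lemma hyp_swap_near_conformal:
  assumes a: "norm (a::'a::euclidean_space) < 1"
  obtains s \<delta> where "0 < s" "0 < \<delta>"
    "\<And>y. norm (y - a) < \<delta> \<Longrightarrow> norm y < 1 \<and> s * norm (y - a) \<le> norm (hyp_swap a y)
        \<and> norm (hyp_swap a y) \<le> 2 * s * norm (y - a)"
proof -
  define m where "m = (1 - (norm a)\<^sup>2)\<^sup>2"
  have m: "0 < m" using one_minus_norm_sq_pos[OF a] by (simp add: m_def)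
  define D where "D y = 1 - 2 * (a \<bullet> y) + (norm a)\<^sup>2 * (norm y)\<^sup>2" for y
  have "D a = 1 - 2 * (norm a)\<^sup>2 + (norm a)\<^sup>2 * (norm a)\<^sup>2"
    by (simp add: D_def power2_norm_eq_inner)
  then have Da: "D a = m" unfolding m_def by (simp add: power2_eq_square[of "1 - _"] algebra_simps)
  have "isCont D a" unfolding D_def by (intro continuous_intros)
  then obtain d where d: "0 < d" "\<And>y. dist y a < d \<Longrightarrow> dist (D y) (D a) < m / 2"
    unfolding continuous_at_eps_delta using m by (meson half_gt_zero)
  define s where "s = sqrt (1 / (2 * m))"
  show thesis
  proof (rule that)
    show "0 < s" using m by (simp add: s_def)
    show "0 < min d (1 - norm a)" using d a by simp
    fix y assume y: "norm (y - a) < min d (1 - norm a)"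
    have y1: "norm y < 1" using y norm_triangle_sub[of y a] by linarith
    have "\<bar>D y - m\<bar> < m / 2" using d(2)[of y] y Da by (simp add: dist_norm)
    then have D: "m / 2 \<le> D y" "D y \<le> 2 * m" "0 < D y" using m by linarith+
    have "(norm (hyp_swap a y))\<^sup>2 = m * (norm (y - a))\<^sup>2 / (D y * D a)"
      using norm_sq_hyp_swap_diff[OF a y1 a] by (simp add: m_def D_def)
    then have e: "(norm (hyp_swap a y))\<^sup>2 = (norm (y - a))\<^sup>2 / D y" using m by (simp add: Da)
    have "(s * norm (y - a))\<^sup>2 = (norm (y - a))\<^sup>2 / (2 * m)"
      using m by (simp add: s_def power_mult_distrib)
    also have "\<dots> \<le> (norm (y - a))\<^sup>2 / D y" using D m by (intro divide_left_mono) auto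
    finally have 1: "s * norm (y - a) \<le> norm (hyp_swap a y)"
      unfolding e[symmetric] by (rule power2_le_imp_le) simp
    have "(norm (hyp_swap a y))\<^sup>2 \<le> (norm (y - a))\<^sup>2 / (m / 2)"
      unfolding e using D m by (intro divide_left_mono) auto
    also have "\<dots> = (2 * s * norm (y - a))\<^sup>2"
      using m by (simp add: s_def power_mult_distrib)
    finally have 2: "norm (hyp_swap a y) \<le> 2 * s * norm (y - a)"
      by (rule power2_le_imp_le) (use m in \<open>simp add: s_def\<close>)
    show "norm y < 1 \<and> s * norm (y - a) \<le> norm (hyp_swap a y)
        \<and> norm (hyp_swap a y) \<le> 2 * s * norm (y - a)"
      using y1 1 2 by blast
  qed
qed

lemma linear_dilatation_le:
  fixes f :: "'a::euclidean_space \<Rightarrow> 'b::euclidean_space"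
  assumes r: "0 < r" and H: "0 < H"
    and le: "\<And>y z. norm (y - x) = r \<Longrightarrow> norm (z - x) = r \<Longrightarrow> norm (f y - f x) \<le> H * norm (f z - f x)"
  shows "linear_dilatation f x r \<le> H"
proof -
  define m where "m = (INF y\<in>sphere x r. norm (f x - f y))"
  have ne: "sphere x r \<noteq> {}" using r by simp
  have bdd: "bdd_below ((\<lambda>y. norm (f x - f y)) ` sphere x r)" by (rule bdd_belowI[of _ 0]) auto
  have m: "0 \<le> m" unfolding m_def using ne by (intro cINF_greatest) auto
  have "(SUP y\<in>sphere x r. norm (f x - f y)) \<le> H * m"
  proof (rule cSUP_least[OF ne])
    fix y assume y: "y \<in> sphere x r"
    have "norm (f x - f y) / H \<le> m"
      unfolding m_def
    proof (rule cINF_greatest[OF ne])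
      fix z assume "z \<in> sphere x r"
      then show "norm (f x - f y) / H \<le> norm (f x - f z)"
        using le[of y z] y H by (simp add: dist_norm norm_minus_commute divide_le_eq mult.commute)
    qed
    then show "norm (f x - f y) \<le> H * m" using H by (simp add: divide_le_eq mult.commute)
  qed
  then show ?thesis
    unfolding linear_dilatation_def m_def[symmetric] using m H
    by (cases "m = 0") (auto simp: divide_le_eq)
qed

text \<open>The factor 2 in \<open>weak_quasisymmetry_at_0\<close> absorbs the distortion of spheres by \<open>hyp_swap x\<close>, and the
  factor 2 in the bound comes from \<open>hyp_swap (f x)\<close>.\<close>

lemma dilatation_bound:
  fixes f :: "'a::euclidean_space \<Rightarrow> 'a"
  assumes dim: "2 \<le> DIM('a)" and \<sigma>: "1 \<le> \<sigma>" and fg: "homeomorphism (ball 0 1) (ball 0 1) f g"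
    and skew: "equilateral_skew_bounded \<sigma> f" and x: "norm x < 1"
  shows "\<forall>\<^sub>F r in at_right 0. linear_dilatation f x r \<le> 2 * (1 + 12 * \<sigma>) ^ 20"
proof -
  have im: "f ` ball 0 1 = ball 0 1" using fg by (simp add: homeomorphism_def)
  define b where "b = f x"
  have b: "norm b < 1" using im x by (force simp: b_def)
  define F where "F = hyp_swap b \<circ> (f \<circ> hyp_swap x)"
  define G where "G = (hyp_swap x \<circ> g) \<circ> hyp_swap b"
  have hom: "homeomorphism (ball 0 1) (ball 0 1) F G"
    unfolding F_def G_def
    by (rule homeomorphism_compose[OF homeomorphism_compose[OF homeomorphism_hyp_swap[OF x] fg]
          homeomorphism_hyp_swap[OF b]])
  have F0: "F 0 = 0" by (simp add: F_def b_def)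
  have sF: "equilateral_skew_bounded \<sigma> F"
    using equilateral_skew_bounded_conj[OF skew _ x b] im by (simp add: F_def comp_def)
  have cF: "continuous_on (ball 0 1) F" using hom by (simp add: homeomorphism_def)
  obtain R where R: "0 < R" "R \<le> 1"
    "\<And>p q w. norm p < R \<Longrightarrow> norm q < R \<Longrightarrow> norm w < R \<Longrightarrow> hyp_quot p q = hyp_quot q w \<Longrightarrow>
        hyp_quot p q = hyp_quot p w \<Longrightarrow> norm (F w) \<le> (1 + 12 * \<sigma>) * max (norm (F p)) (norm (F q))"
    using equilateral_skew_bounded_near_0[OF sF \<sigma> cF F0] by blast
  define K where "K = 1 + 12 * \<sigma>"
  interpret growth_at_0 F G K R
    by unfold_locales (use hom F0 \<sigma> R in \<open>auto simp: K_def\<close>)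
  obtain s \<delta> where s: "0 < s" "0 < \<delta>"
    and sw: "\<And>y. norm (y - x) < \<delta> \<Longrightarrow> norm y < 1 \<and> s * norm (y - x) \<le> norm (hyp_swap x y)
        \<and> norm (hyp_swap x y) \<le> 2 * s * norm (y - x)"
    using hyp_swap_near_conformal[OF x] by blast
  obtain s' \<delta>' where s': "0 < s'" "0 < \<delta>'"
    and sw': "\<And>y. norm (y - b) < \<delta>' \<Longrightarrow> norm y < 1 \<and> s' * norm (y - b) \<le> norm (hyp_swap b y)
        \<and> norm (hyp_swap b y) \<le> 2 * s' * norm (y - b)"
    using hyp_swap_near_conformal[OF b] by blast
  have "isCont f x" using fg x by (simp add: homeomorphism_def continuous_on_eq_continuous_at)
  then obtain d where d: "0 < d" "\<And>y. norm (y - x) < d \<Longrightarrow> norm (f y - b) < \<delta>'"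
    unfolding continuous_at_eps_delta dist_norm b_def using s' by blast
  define r0 where "r0 = min (min \<delta> d) (min (1 / (200000 * s)) (R / (80 * s)))"
  have r0: "0 < r0" using s d R by (simp add: r0_def)
  have K: "0 < K ^ 20" using K by simp
  have "linear_dilatation f x r \<le> 2 * K ^ 20" if r: "0 < r" "r < r0" for r
  proof (rule linear_dilatation_le[OF r(1)])
    show "0 < 2 * K ^ 20" using K by simp
    fix y z assume yz: "norm (y - x) = r" "norm (z - x) = r"
    have small: "r < \<delta>" "r < d" using r by (simp_all add: r0_def)
    have "r < 1 / (200000 * s)" "r < R / (80 * s)" using r by (simp_all add: r0_def)
    then have sr: "2 * s * r \<le> 1 / 100000" "40 * (2 * s * r) < R" using s by (simp_all add: field_simps)
    define Y Z where "Y = hyp_swap x y" and "Z = hyp_swap x z"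
    have Y: "norm Y \<le> 2 * s * r" and y1: "norm y < 1" using sw[of y] yz small by (simp_all add: Y_def)
    have Z: "s * r \<le> norm Z" "norm Z \<le> 2 * s * r" and z1: "norm z < 1"
      using sw[of z] yz small by (simp_all add: Z_def)
    have "0 < s * r" using s r by simp
    then have main: "norm (F Y) \<le> K ^ 20 * norm (F Z)"
      using Y Z sr by (intro weak_quasisymmetry_at_0[OF dim]) linarith+
    have FY: "F Y = hyp_swap b (f y)" "F Z = hyp_swap b (f z)"
      by (simp_all add: F_def Y_def Z_def hyp_swap_hyp_swap x y1 z1)
    have "s' * norm (f y - b) \<le> norm (F Y)" unfolding FY using sw'[OF d(2)[of y]] yz small by simp
    also note main
    also have "K ^ 20 * norm (F Z) \<le> K ^ 20 * (2 * s' * norm (f z - b))"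
      unfolding FY using sw'[OF d(2)[of z]] yz small K by (intro mult_left_mono) auto
    also have "\<dots> = s' * (2 * K ^ 20 * norm (f z - b))" by simp
    finally show "norm (f y - f x) \<le> 2 * K ^ 20 * norm (f z - f x)"
      unfolding b_def using s' by (simp only: mult_le_cancel_left_pos)
  qed
  then show ?thesis
    unfolding K_def[symmetric] eventually_at_right_field using r0 by blast
qed

theorem theorem1p2:
  fixes f :: "real ^ 'n \<Rightarrow> real ^ 'n" and \<sigma> :: real
  assumes "CARD('n) \<ge> 2"
    and "\<sigma> \<ge> 1"
    and "\<exists>g. homeomorphism (ball 0 1) (ball 0 1) f g"
    and "\<And>T. equilateral_hyp_triangle T \<Longrightarrow> hyp_skew (triangle_image f T) \<le> \<sigma>"
  shows "quasiconformal_on f (ball 0 1)"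
proof -
  obtain g where fg: "homeomorphism (ball 0 1) (ball 0 1) f g" using assms(3) by blast
  then have im: "f ` ball 0 1 = ball 0 1" and "\<And>x. x \<in> ball 0 1 \<Longrightarrow> g (f x) = x"
    by (simp_all add: homeomorphism_def)
  then have inj: "inj_on f (ball 0 1)" by (metis inj_onI)
  have skew: "equilateral_skew_bounded \<sigma> f"
    using equilateral_skew_boundedI[OF inj _ assms(4)] im by simp
  have "Limsup (at_right 0) (\<lambda>r. ereal (linear_dilatation f x r)) \<le> ereal (2 * (1 + 12 * \<sigma>) ^ 20)"
    if "x \<in> ball 0 1" for x
    using dilatation_bound[OF _ assms(2) fg skew, of x] that assms(1)
    by (intro Limsup_bounded) simp
  moreover have "\<exists>g. homeomorphism (ball 0 1) (f ` ball 0 1) f g" using fg im by auto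
  ultimately show ?thesis
    unfolding quasiconformal_on_def
    by (intro conjI exI[of _ "2 * (1 + 12 * \<sigma>) ^ 20"]) auto
qed

end
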